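(* Let $s\in(0,1)$ and $p>0$. The equation $$(-\Delta)^su=u^{-p}\quad\text{in }\mathbb{R}^n$$ does not have a positive viscosity solution $u$ satisfying $|u(x)|\leq C(1+|x|)^\gamma$ for all $x\in\mathbb{R}^n$ (for some constant $C$), provided one of the following holds: (i) $2s\leq1$ and $\gamma<2s$; (ii) $2s>1$ and either $\gamma<1$ or $$2s>\gamma\left[1+(p+1)\frac{2s}{2s-1}\right].$$
   Context: $(-\Delta)^s$ is the fractional Laplacian: up to a positive normalizing constant $c_{n,s}$, $(-\Delta)^su(x)=-c_{n,s}\,\mathrm{P.V.}\int_{\mathbb{R}^n}(u(x+z)-u(x))\frac{dz}{|z|^{n+2s}}$. Let $\omega_s(z)=(1+|z|)^{-n-2s}$ and let $L^1(\omega_s)$ be the functions integrable against $\omega_s$. Viscosity solutions: a measurable $u:\mathbb{R}^n\to(0,\infty)$ in $L^1(\omega_s)$, upper (resp. lower) semicontinuous, is a viscosity subsolution (resp. supersolution) of $(-\Delta)^su=u^{-p}$ in $\mathbb{R}^n$ if for each $x_0\in\mathbb{R}^n$ and $\varphi\in C^2(B_r(x_0))$, for some $r>0$, with $u(x_0)=\varphi(x_0)$ and $u\leq\varphi$ (resp. $u\geq\varphi$) in $B_r(x_0)$, one has $(-\Delta)^sv(x_0)\leq u(x_0)^{-p}$ (resp. $\geq u(x_0)^{-p}$), where $v=\varphi$ in $B_r(x_0)$ and $v=u$ elsewhere. A viscosity solution is both a sub- and a supersolution. *)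

theory Defs
  imports "HOL-Analysis.Analysis"
begin

text \<open>The space \<open>\<real>\<^sup>n\<close> is the type \<open>real ^ 'n\<close>, with \<open>n = CARD('n)\<close>.\<close>

definition weight :: "real \<Rightarrow> real ^ 'n \<Rightarrow> real" where
  "weight s z = (1 + norm z) powr (- real CARD('n) - 2 * s)"

definition in_L1_weight :: "real \<Rightarrow> (real ^ 'n \<Rightarrow> real) \<Rightarrow> bool" where
  "in_L1_weight s u \<longleftrightarrow> integrable lborel (\<lambda>z. u z * weight s z)"

text \<open>
  The principal value is the limit of the integrals over the complements of shrinking balls.
  The parameter \<open>c\<close> is the normalizing constant. \<^const>\<open>Lim\<close> and the Lebesgue integral
  take arbitrary values where they do not exist; for \<open>u\<close> integrable against the weight and
  twice continuously differentiable near \<open>x\<close> both do.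
\<close>
definition frac_laplacian ::
    "real \<Rightarrow> real \<Rightarrow> (real ^ 'n \<Rightarrow> real) \<Rightarrow> real ^ 'n \<Rightarrow> real" where
  "frac_laplacian c s u x =
     - c * Lim (at_right 0) (\<lambda>\<epsilon>. LINT z:{z. \<epsilon> < norm z}|lborel.
             (u (x + z) - u x) / norm z powr (real CARD('n) + 2 * s))"

definition upper_semicontinuous :: "('a::topological_space \<Rightarrow> real) \<Rightarrow> bool" where
  "upper_semicontinuous u \<longleftrightarrow> (\<forall>x a. u x < a \<longrightarrow> (\<forall>\<^sub>F y in nhds x. u y < a))"

definition lower_semicontinuous :: "('a::topological_space \<Rightarrow> real) \<Rightarrow> bool" where
  "lower_semicontinuous u \<longleftrightarrow> (\<forall>x a. a < u x \<longrightarrow> (\<forall>\<^sub>F y in nhds x. a < u y))"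

text \<open>\<open>D\<close> is the gradient and \<open>H\<close> the Hessian matrix of \<open>f\<close>; \<open>S\<close> is meant to be open.\<close>
definition C2_on :: "(real ^ 'n) set \<Rightarrow> (real ^ 'n \<Rightarrow> real) \<Rightarrow> bool" where
  "C2_on S f \<longleftrightarrow>
     (\<exists>(D :: real ^ 'n \<Rightarrow> real ^ 'n) (H :: real ^ 'n \<Rightarrow> real ^ 'n ^ 'n).
        (\<forall>x\<in>S. (f has_derivative (\<lambda>h. D x \<bullet> h)) (at x)) \<and>
        (\<forall>x\<in>S. (D has_derivative (\<lambda>h. H x *v h)) (at x)) \<and>
        continuous_on S H)"

definition glue :: "real ^ 'n \<Rightarrow> real \<Rightarrow> (real ^ 'n \<Rightarrow> real) \<Rightarrow> (real ^ 'n \<Rightarrow> real) \<Rightarrow> real ^ 'n \<Rightarrow> real" where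
  "glue x0 r \<phi> u x = (if x \<in> ball x0 r then \<phi> x else u x)"

text \<open>
  A test function that is \<open>C\<^sup>2\<close> on the open ball may fail to be integrable near the
  bounding sphere. Then the fractional Laplacian of the glued function at \<open>x0\<close> is
  \<open>-\<infinity>\<close> when touching from above and \<open>+\<infinity>\<close> when touching from below, and the required
  inequality is void. Since the Lebesgue integral of a non-integrable function is \<open>0\<close> here,
  these test functions are left out by the assumption \<^const>\<open>in_L1_weight\<close> on the glued
  function, which holds in all other cases.
\<close>
definition viscosity_subsolution ::
    "real \<Rightarrow> real \<Rightarrow> real \<Rightarrow> (real ^ 'n \<Rightarrow> real) \<Rightarrow> bool" where
  "viscosity_subsolution c s p u \<longleftrightarrow>
     u \<in> borel_measurable lebesgue \<and> (\<forall>x. 0 < u x) \<and> in_L1_weight s u \<and>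
     upper_semicontinuous u \<and>
     (\<forall>x0 r \<phi>. 0 < r \<and> C2_on (ball x0 r) \<phi> \<and> u x0 = \<phi> x0 \<and>
        (\<forall>x\<in>ball x0 r. u x \<le> \<phi> x) \<and> in_L1_weight s (glue x0 r \<phi> u) \<longrightarrow>
        frac_laplacian c s (glue x0 r \<phi> u) x0 \<le> u x0 powr (- p))"

definition viscosity_supersolution ::
    "real \<Rightarrow> real \<Rightarrow> real \<Rightarrow> (real ^ 'n \<Rightarrow> real) \<Rightarrow> bool" where
  "viscosity_supersolution c s p u \<longleftrightarrow>
     u \<in> borel_measurable lebesgue \<and> (\<forall>x. 0 < u x) \<and> in_L1_weight s u \<and>
     lower_semicontinuous u \<and>
     (\<forall>x0 r \<phi>. 0 < r \<and> C2_on (ball x0 r) \<phi> \<and> u x0 = \<phi> x0 \<and>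
        (\<forall>x\<in>ball x0 r. u x \<ge> \<phi> x) \<and> in_L1_weight s (glue x0 r \<phi> u) \<longrightarrow>
        frac_laplacian c s (glue x0 r \<phi> u) x0 \<ge> u x0 powr (- p))"

definition viscosity_solution ::
    "real \<Rightarrow> real \<Rightarrow> real \<Rightarrow> (real ^ 'n \<Rightarrow> real) \<Rightarrow> bool" where
  "viscosity_solution c s p u \<longleftrightarrow>
     viscosity_subsolution c s p u \<and> viscosity_supersolution c s p u"

end

theory Submission
  imports Defs
begin

text \<open>
  Either alternative on \<open>\<gamma>\<close> forces \<open>\<gamma> < min 1 (2 s)\<close>, so the growth bound holds with an exponent
  \<open>g\<close> in \<open>(0, min 1 (2 s))\<close>; fix \<open>b\<close> with \<open>g < b < min 1 (2 s)\<close>. If \<open>u\<close> is not constant, then for some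
  \<open>L > 0\<close> and all large \<open>R\<close> the function \<open>u x - u y - L |x - y|\<^sup>b - R\<^sup>g \<eta> (x / R)\<close>, with
  \<open>\<eta> x = (1 + |x|\<^sup>2) powr (b / 2) - 1\<close>, has a positive maximum; since \<open>u > 0\<close>, the maximum point
  satisfies \<open>|x| \<le> K R\<close> and \<open>|x - y|\<^sup>b \<le> B R\<^sup>g\<close>. As \<open>t \<mapsto> t powr (-p)\<close> is decreasing, the right-hand
  sides of the two viscosity inequalities drop out of their difference, and the strict concavity of
  \<open>t \<mapsto> t\<^sup>b\<close> leaves \<open>L \<kappa> |x - y| powr (b - 2 s) \<le> 2 E R powr (g - 2 s)\<close>. With the bound on \<open>|x - y|\<close>
  this fails for large \<open>R\<close> because \<open>g < b\<close>. Hence \<open>u\<close> is constant, which the equation excludes.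
\<close>

section \<open>Integrals of powers of the norm\<close>

lemma nn_integral_lborel_affine:
  fixes t :: "'a::euclidean_space"
  assumes [measurable]: "f \<in> borel_measurable borel" and c: "c \<noteq> 0"
  shows "(\<integral>\<^sup>+x. f x \<partial>lborel) = ennreal (\<bar>c\<bar> ^ DIM('a)) * (\<integral>\<^sup>+x. f (t + c *\<^sub>R x) \<partial>lborel)"
  by (subst lborel_affine[OF c, of t])
     (simp add: nn_integral_density nn_integral_distr nn_integral_cmult)

lemma lborel_integrable_affine:
  fixes f :: "'a::euclidean_space \<Rightarrow> real"
  assumes f: "integrable lborel f" and c: "c \<noteq> 0"
  shows "integrable lborel (\<lambda>x. f (t + c *\<^sub>R x))"
  using f f[THEN borel_measurable_integrable] c unfolding integrable_iff_bounded
  by (subst (asm) nn_integral_lborel_affine[where c=c and t=t]) (auto simp: ennreal_mult_less_top)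

lemma lborel_integral_affine:
  fixes f :: "'a::euclidean_space \<Rightarrow> real"
  assumes f: "integrable lborel f" and c: "c \<noteq> 0"
  shows "(\<integral>x. f x \<partial>lborel) = \<bar>c\<bar> ^ DIM('a) * (\<integral>x. f (t + c *\<^sub>R x) \<partial>lborel)"
  using c f[THEN borel_measurable_integrable] lborel_integrable_affine[OF f c, of t]
  by (subst lborel_affine[OF c, of t]) (simp add: integral_density integral_distr)

text \<open>Pointwise \<open>f\<close> is at most the series of \<open>a k\<close> times the
  indicator of the ball of radius \<open>\<rho> k\<close>. Integrating termwise gives the volume of
  the unit ball times the summable series.\<close>

lemma integrable_le_suminf_balls:
  fixes f :: "'a::euclidean_space \<Rightarrow> real"
  assumes f: "f \<in> borel_measurable borel" "\<And>z. 0 \<le> f z"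
    and ex: "\<And>z. f z \<noteq> 0 \<Longrightarrow> \<exists>k. norm z < \<rho> k \<and> f z \<le> a k"
    and nonneg: "\<And>k. 0 \<le> a k" "\<And>k. 0 \<le> \<rho> k"
    and sum: "summable (\<lambda>k. a k * \<rho> k ^ DIM('a))"
  shows "integrable lborel f"
proof (rule integrableI_nonneg)
  let ?V = "unit_ball_vol (DIM('a))"
  have le: "ennreal (f z) \<le> (\<Sum>k. ennreal (a k) * indicator (ball 0 (\<rho> k)) z)" for z
  proof (cases "f z = 0")
    case False
    with ex obtain k where k: "norm z < \<rho> k" "f z \<le> a k" by blast
    have "ennreal (f z) \<le> ennreal (a k) * indicator (ball 0 (\<rho> k)) z"
      using k by (simp add: ennreal_leI)
    also have "\<dots> = (\<Sum>k\<in>{k}. ennreal (a k) * indicator (ball 0 (\<rho> k)) z)"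
      by (simp only: sum.insert finite.emptyI empty_iff not_False_eq_True sum.empty add_0_right)
    also have "\<dots> \<le> (\<Sum>k. ennreal (a k) * indicator (ball 0 (\<rho> k)) z)"
      by (rule sum_le_suminf) auto
    finally show ?thesis .
  qed simp
  have "(\<integral>\<^sup>+z. f z \<partial>lborel) \<le> (\<integral>\<^sup>+(z::'a). (\<Sum>k. ennreal (a k) * indicator (ball 0 (\<rho> k)) z) \<partial>lborel)"
    by (intro nn_integral_mono le)
  also have "\<dots> = (\<Sum>k. \<integral>\<^sup>+(z::'a). ennreal (a k) * indicator (ball 0 (\<rho> k)) z \<partial>lborel)"
    by (intro nn_integral_suminf borel_measurable_times_ennreal borel_measurable_indicator) auto
  also have "\<dots> = (\<Sum>k. ennreal (?V * (a k * \<rho> k ^ DIM('a))))"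
    using nonneg
    by (intro suminf_cong) (simp add: nn_integral_cmult_indicator emeasure_ball ennreal_mult'[symmetric] mult_ac)
  also have "\<dots> < \<infinity>"
    using sum nonneg by (subst suminf_ennreal2) (auto intro!: summable_mult)
  finally show "(\<integral>\<^sup>+z. f z \<partial>lborel) < \<infinity>" .
qed (use f in auto)

lemma powr_le_two_powr_abs:
  fixes t e :: real
  assumes "1/2 \<le> t" "t \<le> 2"
  shows "t powr e \<le> 2 powr \<bar>e\<bar>"
proof (cases "0 \<le> e")
  case True
  then show ?thesis using assms powr_mono2[of e t 2] by simp
next
  case False
  then have "t powr e \<le> (1/2) powr e" using assms powr_mono2'[of e "1/2" t] by simp
  also have "\<dots> = 2 powr \<bar>e\<bar>" using False by (simp add: powr_divide powr_minus_divide)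
  finally show ?thesis .
qed

text \<open>Dyadic decomposition: where the norm is comparable to \<open>b ^ k\<close>, the
  integrand is comparable to \<open>(b ^ k) powr e\<close> and the volume to the
  \<open>DIM('a)\<close>-th power of \<open>b ^ k\<close>. The series is geometric with ratio
  \<open>b powr (e + DIM('a))\<close>. Taking \<open>b = 1/2\<close> treats the origin,
  \<open>b = 2\<close> treats infinity.\<close>

lemma integrable_norm_powr_on:
  fixes S :: "'a::euclidean_space set"
    and e :: real
  assumes S: "S \<in> sets borel" and b: "0 < b" "b powr (e + DIM('a)) < 1"
    and ex: "\<And>z. z \<in> S \<Longrightarrow> z \<noteq> 0 \<Longrightarrow> \<exists>k. b ^ k \<le> norm z * 2 \<and> norm z < 2 * b ^ k"
  shows "integrable lborel (\<lambda>z. indicator S z * norm z powr e)"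
proof (rule integrable_le_suminf_balls[where \<rho> = "\<lambda>k. 2 * b ^ k" and a = "\<lambda>k. 2 powr \<bar>e\<bar> * (b ^ k) powr e"])
  show "(\<lambda>z. indicator S z * norm z powr e) \<in> borel_measurable borel"
    using S by measurable
  show "\<exists>k. norm z < 2 * b ^ k \<and> indicator S z * norm z powr e \<le> 2 powr \<bar>e\<bar> * (b ^ k) powr e"
    if "indicator S z * norm z powr e \<noteq> 0" for z
  proof -
    have "z \<in> S" "z \<noteq> 0" using that by (auto split: split_indicator_asm)
    with ex obtain k where k: "b ^ k \<le> norm z * 2" "norm z < 2 * b ^ k" by blast
    define t where "t = norm z / b ^ k"
    have bk: "0 < b ^ k" using b by simp
    have t: "1/2 \<le> t" "t \<le> 2" using k bk by (auto simp: t_def field_simps)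
    have "norm z powr e = t powr e * (b ^ k) powr e"
      using b bk t by (subst powr_mult[symmetric]) (auto simp: t_def)
    also have "\<dots> \<le> 2 powr \<bar>e\<bar> * (b ^ k) powr e"
      by (intro mult_right_mono powr_le_two_powr_abs t) simp
    finally show ?thesis using k \<open>z \<in> S\<close> by auto
  qed
  have eq: "2 powr \<bar>e\<bar> * (b ^ k) powr e * (2 * b ^ k) ^ DIM('a)
      = 2 powr \<bar>e\<bar> * 2 ^ DIM('a) * (b powr (e + DIM('a))) ^ k" for k
  proof -
    have "(b ^ k) powr e = (b powr e) ^ k"
      using b by (simp add: powr_realpow[symmetric] powr_powr mult.commute)
    moreover have "(b powr (e + DIM('a))) ^ k = (b powr e) ^ k * (b ^ k) ^ DIM('a)"
      using b by (simp add: powr_add powr_realpow power_mult_distrib power_mult[symmetric] mult.commute)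
    ultimately show ?thesis by (simp add: power_mult_distrib)
  qed
  show "summable (\<lambda>k. 2 powr \<bar>e\<bar> * (b ^ k) powr e * (2 * b ^ k) ^ DIM('a))"
    unfolding eq using b by (intro summable_mult summable_geometric) simp
qed (use b in auto)

lemma ex_dyadic_half:
  fixes x :: real
  assumes "0 < x" "x < 1"
  shows "\<exists>k. (1/2) ^ k \<le> x * 2 \<and> x < 2 * (1/2) ^ k"
proof -
  obtain m where m: "(1/2::real) ^ m < x" using real_arch_pow_inv[OF assms(1), of "1/2"] by auto
  define k where "k = (LEAST k. (1/2::real) ^ k < x)"
  have k: "(1/2::real) ^ k < x" unfolding k_def by (rule LeastI) (fact m)
  have "k \<noteq> 0" using k assms by (cases k) auto
  \<comment> \<open>Minimality of \<open>k\<close> puts \<open>x\<close> between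
    \<open>(1/2) ^ k\<close> and \<open>(1/2) ^ (k - 1)\<close>, so \<open>k - 1\<close> is the
    witness.\<close>
  then have "\<not> (1/2::real) ^ (k - 1) < x"
    unfolding k_def by (intro not_less_Least) simp
  then have "x \<le> 2 * (1/2) ^ k" using \<open>k \<noteq> 0\<close> by (cases k) auto
  then have "x \<le> (1/2) ^ (k - 1)" using \<open>k \<noteq> 0\<close> by (cases k) auto
  moreover have "(1/2::real) ^ (k-1) < 2 * (1/2) ^ (k-1)" by simp
  moreover have "(1/2::real) ^ (k-1) < x * 2" using k \<open>k \<noteq> 0\<close> by (cases k) auto
  ultimately show ?thesis by (intro exI[of _ "k - 1"]) linarith
qed

lemma ex_dyadic_two:
  fixes x :: real
  assumes "1 \<le> x"
  shows "\<exists>k. 2 ^ k \<le> x * 2 \<and> x < 2 * 2 ^ k"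
proof -
  obtain m where m: "x < (2::real) ^ m" using real_arch_pow[of "2::real" x] by auto
  define k where "k = (LEAST k. x < (2::real) ^ k)"
  have k: "x < (2::real) ^ k" unfolding k_def by (rule LeastI) (fact m)
  have "k \<noteq> 0" using k assms by (cases k) auto
  then have "\<not> x < (2::real) ^ (k - 1)"
    unfolding k_def by (intro not_less_Least) simp
  then have "2 ^ k \<le> x * 2" using \<open>k \<noteq> 0\<close> by (cases k) auto
  moreover have "x < 2 * 2 ^ k" using k assms by linarith
  ultimately show ?thesis by blast
qed

lemma integrable_norm_powr_ball:
  fixes e :: real
  assumes "0 < e + DIM('a::euclidean_space)"
  shows "integrable lborel (\<lambda>z::'a. indicator (ball 0 1) z * norm z powr e)"
proof (rule integrable_norm_powr_on[where b = "1/2"])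
  show "(1/2) powr (e + DIM('a)) < 1"
    using powr_less_mono2[of "e + DIM('a)" "1/2" 1] assms by simp
qed (auto intro: ex_dyadic_half)

lemma integrable_norm_powr_tail:
  fixes e :: real
  assumes "e + DIM('a::euclidean_space) < 0"
  shows "integrable lborel (\<lambda>z::'a. indicator (- ball 0 1) z * norm z powr e)"
proof (rule integrable_norm_powr_on[where b = 2])
  show "2 powr (e + DIM('a)) < 1"
    using powr_less_mono[of "e + DIM('a)" 0 2] assms by simp
qed (auto intro: ex_dyadic_two)

text \<open>The kernel is of order \<open>-n - 2 * s\<close>. A quadratic zero at the origin
  compensates its singularity because \<open>s < 1\<close>, and growth of order
  \<open>b < 2 * s\<close> leaves an integrable tail.\<close>

lemma integrable_levy:
  fixes f :: "real ^ 'n \<Rightarrow> real"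
  assumes "0 < s" "s < 1" "b < 2 * s" and [measurable]: "f \<in> borel_measurable borel"
    and near: "\<And>z. norm z < 1 \<Longrightarrow> \<bar>f z\<bar> \<le> A * (norm z)\<^sup>2"
    and far: "\<And>z. 1 \<le> norm z \<Longrightarrow> \<bar>f z\<bar> \<le> B * norm z powr b"
  shows "integrable lborel (\<lambda>z. f z / norm z powr (real CARD('n) + 2 * s))"
proof (rule Bochner_Integration.integrable_bound)
  let ?q = "real CARD('n) + 2 * s"
  let ?g = "\<lambda>z::real^'n. A * (indicator (ball 0 1) z * norm z powr (2 - ?q))
     + B * (indicator (- ball 0 1) z * norm z powr (b - ?q))"
  show "integrable lborel ?g"
    using assms(1-3)
    by (intro Bochner_Integration.integrable_add integrable_mult_right
        integrable_norm_powr_ball integrable_norm_powr_tail) auto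
  show "AE z in lborel. norm (f z / norm z powr ?q) \<le> norm (?g z)"
  proof (rule AE_I2)
    fix z :: "real ^ 'n"
    show "norm (f z / norm z powr ?q) \<le> norm (?g z)"
    proof (cases "norm z < 1")
      case True
      have "\<bar>f z\<bar> / norm z powr ?q \<le> A * (norm z)\<^sup>2 / norm z powr ?q"
        using near[OF True] by (intro divide_right_mono) auto
      also have "\<dots> = ?g z"
        using True by (cases "z = 0") (auto simp: powr_diff)
      finally show ?thesis by simp
    next
      case False
      then have "\<bar>f z\<bar> / norm z powr ?q \<le> B * norm z powr b / norm z powr ?q"
        using far[of z] by (intro divide_right_mono) auto
      also have "\<dots> = ?g z"
        using False by (auto simp: powr_diff)
      finally show ?thesis by simp
    qed
  qed
qed measurable


section \<open>The fractional Laplacian by second differences\<close>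

text \<open>In this symmetric form the gradient term cancels, so for \<open>v\<close> of class C2
  near \<open>x\<close> it is quadratically small in \<open>z\<close>, as
  \<open>integrable_levy\<close> demands.\<close>

definition second_diff :: "('a::real_vector \<Rightarrow> real) \<Rightarrow> 'a \<Rightarrow> 'a \<Rightarrow> real" where
  "second_diff v x z = v (x + z) + v (x - z) - 2 * v x"

lemma weight_pos: "0 < weight s z"
proof -
  have "1 + norm z \<noteq> 0" using norm_ge_zero[of z] by linarith
  then show ?thesis by (simp add: weight_def)
qed

text \<open>The product with the weight is Borel measurable, and dividing by the positive weight
  recovers \<open>u\<close>. This improves on the Lebesgue measurability in the definition of
  viscosity solutions.\<close>

lemma in_L1_weight_imp_measurable:
  assumes "in_L1_weight s u"
  shows "u \<in> borel_measurable borel"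
proof -
  have [measurable]: "(\<lambda>z. u z * weight s z) \<in> borel_measurable borel"
    using borel_measurable_integrable[OF assms[unfolded in_L1_weight_def]] by simp
  have [measurable]: "weight s \<in> borel_measurable (borel :: (real^'a) measure)"
    unfolding weight_def by measurable
  have "(\<lambda>z. (u z * weight s z) / weight s z) \<in> borel_measurable borel" by measurable
  also have "(\<lambda>z. (u z * weight s z) / weight s z) = u"
    by (simp add: weight_pos[THEN less_imp_neq, THEN not_sym])
  finally show ?thesis .
qed

text \<open>Off a ball around the origin the kernel is at most a constant times the weight at
  \<open>x + z\<close>. The term with \<open>u (x + z)\<close> is thus dominated by a translate of
  an integrable function, and the constant \<open>u x\<close> is integrated against the tail of the
  kernel.\<close>

lemma integrable_increment_tail:
  fixes u :: "real ^ 'n \<Rightarrow> real"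
  assumes s: "0 < s" "s < 1" and u: "in_L1_weight s u" and \<epsilon>: "0 < \<epsilon>"
  shows "integrable lborel (\<lambda>z. indicator {z. \<epsilon> < norm z} z *
           ((u (x + z) - u x) / norm z powr (real CARD('n) + 2 * s)))"
proof -
  let ?q = "real CARD('n) + 2 * s"
  let ?S = "{z. \<epsilon> < norm z} :: (real^'n) set"
  note [measurable] = in_L1_weight_imp_measurable[OF u]
  have 1: "integrable lborel (\<lambda>z. indicator ?S z / norm z powr ?q)"
  proof (rule integrable_levy[OF s, where b = 0 and A = "1 / \<epsilon>\<^sup>2" and B = 1])
    fix z :: "real^'n"
    have "1 \<le> 1 / \<epsilon>\<^sup>2 * (norm z)\<^sup>2" if "\<epsilon> < norm z"
      using that \<epsilon> power_mono[of \<epsilon> "norm z" 2] by simp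
    then show "\<bar>indicator ?S z\<bar> \<le> 1 / \<epsilon>\<^sup>2 * (norm z)\<^sup>2"
      by (auto split: split_indicator)
  qed (use s in \<open>auto split: split_indicator\<close>)
  \<comment> \<open>With this constant, \<open>1 + norm (x + z) \<le> (1 + norm x) * (1 + norm z)
    \<le> M * norm z\<close> whenever \<open>\<epsilon> < norm z\<close>.\<close>
  define M where "M = (1 + norm x) * (1 + 1 / \<epsilon>)"
  have M: "0 < M" using \<epsilon> by (auto simp: M_def intro!: mult_pos_pos add_pos_nonneg)
  have aux: "inverse (t powr q) \<le> M powr q * w" if "(M * t) powr (- q) \<le> w" "0 < t" for q t w
    using that M by (simp add: powr_mult powr_minus field_simps)
  have 2: "integrable lborel (\<lambda>z. indicator ?S z * (u (x + z) / norm z powr ?q))"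
  proof (rule Bochner_Integration.integrable_bound)
    show "integrable lborel (\<lambda>z. M powr ?q * (u (x + z) * weight s (x + z)))"
      using lborel_integrable_affine[OF u[unfolded in_L1_weight_def], of 1 x] by simp
    show "AE z in lborel. norm (indicator ?S z * (u (x + z) / norm z powr ?q))
        \<le> norm (M powr ?q * (u (x + z) * weight s (x + z)))"
    proof (rule AE_I2)
      fix z :: "real ^ 'n"
      show "norm (indicator ?S z * (u (x + z) / norm z powr ?q))
        \<le> norm (M powr ?q * (u (x + z) * weight s (x + z)))"
      proof (cases "\<epsilon> < norm z")
        case True
        have "1 + norm (x + z) \<le> (1 + norm x) * (1 + norm z)"
        proof -
          have "0 \<le> norm x * norm z" by simp
          moreover have "(1 + norm x) * (1 + norm z) = 1 + norm x + norm z + norm x * norm z"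
            by (simp add: algebra_simps)
          ultimately show ?thesis using norm_triangle_ineq[of x z] by linarith
        qed
        also have "\<dots> \<le> (1 + norm x) * ((1 + 1 / \<epsilon>) * norm z)"
          using True \<epsilon> by (intro mult_left_mono) (auto simp: field_simps)
        finally have "1 + norm (x + z) \<le> M * norm z" by (simp add: M_def mult_ac)
        then have "(M * norm z) powr (- ?q) \<le> weight s (x + z)"
          unfolding weight_def
          using s powr_mono2'[of "- ?q" "1 + norm (x + z)" "M * norm z"]
          by (simp add: add_pos_nonneg)
        then have "inverse (norm z powr ?q) \<le> M powr ?q * weight s (x + z)"
          using True \<epsilon> by (intro aux) auto
        then have "\<bar>u (x + z)\<bar> * inverse (norm z powr ?q) \<le> \<bar>u (x + z)\<bar> * (M powr ?q * weight s (x + z))"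
          by (intro mult_left_mono) auto
        then show ?thesis
          using True weight_pos[of s "x + z"] by (simp add: abs_mult divide_inverse mult_ac)
      qed simp
    qed
  qed measurable
  have "integrable lborel (\<lambda>z. indicator ?S z * (u (x + z) / norm z powr ?q)
      - u x * (indicator ?S z / norm z powr ?q))"
    using 1 2 by (intro Bochner_Integration.integrable_diff integrable_mult_right)
  then show ?thesis by (simp add: algebra_simps diff_divide_distrib)
qed

text \<open>Reflecting \<open>z\<close> turns the principal value into an absolutely convergent integral.\<close>
lemma
  fixes v :: "real ^ 'n \<Rightarrow> real"
  assumes s: "0 < s" "s < 1" and v: "in_L1_weight s v" and \<delta>: "0 < \<delta>"
    and near: "\<And>z. norm z < \<delta> \<Longrightarrow> \<bar>second_diff v x z\<bar> \<le> K * (norm z)\<^sup>2"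
  shows integrable_second_diff:
      "integrable lborel (\<lambda>z. second_diff v x z / norm z powr (real CARD('n) + 2 * s))" (is ?int)
    and frac_laplacian_eq_second_diff:
      "frac_laplacian c s v x =
         - (c / 2) * (\<integral>z. second_diff v x z / norm z powr (real CARD('n) + 2 * s) \<partial>lborel)" (is ?eq)
proof -
  let ?q = "real CARD('n) + 2 * s"
  let ?S = "\<lambda>\<epsilon>. {z. \<epsilon> < norm z} :: (real^'n) set"
  let ?g = "\<lambda>z. second_diff v x z / norm z powr ?q"
  let ?h = "\<lambda>\<epsilon> z. indicator (?S \<epsilon>) z * ((v (x + z) - v x) / norm z powr ?q)"
  note [measurable] = in_L1_weight_imp_measurable[OF v]
  have [measurable]: "(\<lambda>z. second_diff v x z) \<in> borel_measurable borel"
    unfolding second_diff_def by measurable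
  have h: "integrable lborel (?h \<epsilon>)" and h': "integrable lborel (\<lambda>z. ?h \<epsilon> (- z))" if "0 < \<epsilon>" for \<epsilon>
    using integrable_increment_tail[OF s v that, of x]
      lborel_integrable_affine[OF integrable_increment_tail[OF s v that, of x], of "-1" 0] by simp_all
  have hh: "?h \<epsilon> z + ?h \<epsilon> (- z) = indicator (?S \<epsilon>) z * ?g z" for \<epsilon> z
    by (simp add: second_diff_def add_divide_distrib[symmetric] split: split_indicator)
  \<comment> \<open>The second difference splits into this inner part and the two reflected tails in
    \<open>hh\<close>. The cut is at \<open>\<delta>/2\<close> because the inner region is a closed
    ball, while \<open>near\<close> holds on the open ball of radius
    \<open>\<delta>\<close>.\<close>
  let ?f = "\<lambda>z. indicator (- ?S (\<delta>/2)) z * second_diff v x z"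
  have "integrable lborel (\<lambda>z. ?f z / norm z powr ?q)"
  proof (rule integrable_levy[OF s, where b = 0 and A = "\<bar>K\<bar>" and B = "\<bar>K\<bar> * \<delta>\<^sup>2"])
    have *: "\<bar>?f z\<bar> \<le> \<bar>K\<bar> * (norm z)\<^sup>2" for z
    proof (cases "\<delta>/2 < norm z")
      case False
      then have "\<bar>second_diff v x z\<bar> \<le> K * (norm z)\<^sup>2" using \<delta> by (intro near) auto
      also have "\<dots> \<le> \<bar>K\<bar> * (norm z)\<^sup>2" by (intro mult_right_mono) auto
      finally show ?thesis using False by simp
    qed simp
    then show "\<bar>?f z\<bar> \<le> \<bar>K\<bar> * (norm z)\<^sup>2" for z .
    show "\<bar>?f z\<bar> \<le> \<bar>K\<bar> * \<delta>\<^sup>2 * norm z powr 0" if "1 \<le> norm z" for z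
    proof (cases "\<delta>/2 < norm z")
      case False
      then have "(norm z)\<^sup>2 \<le> \<delta>\<^sup>2" using \<delta> by (intro power_mono) auto
      then have "\<bar>K\<bar> * (norm z)\<^sup>2 \<le> \<bar>K\<bar> * \<delta>\<^sup>2" by (intro mult_left_mono) auto
      with *[of z] show ?thesis using that by auto
    qed (use that in auto)
  qed (use s in auto)
  then have "integrable lborel (\<lambda>z. ?f z / norm z powr ?q + (?h (\<delta>/2) z + ?h (\<delta>/2) (- z)))"
    using h[of "\<delta>/2"] h'[of "\<delta>/2"] \<delta> by (intro Bochner_Integration.integrable_add) auto
  then show g: ?int
    unfolding hh by (rule back_subst[of "integrable lborel"]) (auto split: split_indicator)
  have J: "(LINT z:?S \<epsilon>|lborel. (v (x + z) - v x) / norm z powr ?q)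
      = (\<integral>z. indicator (?S \<epsilon>) z * ?g z \<partial>lborel) / 2" if "0 < \<epsilon>" for \<epsilon>
  proof -
    have "(\<integral>z. indicator (?S \<epsilon>) z * ?g z \<partial>lborel) = (\<integral>z. ?h \<epsilon> z \<partial>lborel) + (\<integral>z. ?h \<epsilon> (- z) \<partial>lborel)"
      unfolding hh[symmetric] using h[OF that] h'[OF that] by (rule Bochner_Integration.integral_add)
    also have "(\<integral>z. ?h \<epsilon> (- z) \<partial>lborel) = (\<integral>z. ?h \<epsilon> z \<partial>lborel)"
      using lborel_integral_affine[OF h[OF that], of "-1" 0] by simp
    finally show ?thesis by (simp add: set_lebesgue_integral_def)
  qed
  \<comment> \<open>Dominated convergence along arbitrary sequences tending to 0 from the right,
    with the integrable majorant \<open>\<bar>?g z\<bar>\<close>.\<close>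
  have "((\<lambda>\<epsilon>. (\<integral>z. indicator (?S \<epsilon>) z * ?g z \<partial>lborel) / 2) \<longlongrightarrow> (\<integral>z. ?g z \<partial>lborel) / 2) (at_right 0)"
  proof (rule tendsto_at_right_sequentially[of 0 1])
    fix X :: "nat \<Rightarrow> real" assume X: "\<And>n. 0 < X n" "X \<longlonglongrightarrow> 0"
    have "(\<lambda>n. \<integral>z. indicator (?S (X n)) z * ?g z \<partial>lborel) \<longlonglongrightarrow> (\<integral>z. ?g z \<partial>lborel)"
    proof (rule integral_dominated_convergence[where w = "\<lambda>z. \<bar>?g z\<bar>"])
      show "AE z in lborel. (\<lambda>n. indicator (?S (X n)) z * ?g z) \<longlonglongrightarrow> ?g z"
      proof (rule AE_I2)
        fix z :: "real ^ 'n"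
        show "(\<lambda>n. indicator (?S (X n)) z * ?g z) \<longlonglongrightarrow> ?g z"
        proof (cases "z = 0")
          case False
          then have "\<forall>\<^sub>F n in sequentially. X n < norm z"
            using X(2) by (intro order_tendstoD) auto
          then have "\<forall>\<^sub>F n in sequentially. indicator (?S (X n)) z * ?g z = ?g z"
            by eventually_elim simp
          then show ?thesis by (rule tendsto_eventually)
        qed simp
      qed
      show "integrable lborel (\<lambda>z. \<bar>?g z\<bar>)" using g by (rule integrable_abs)
    qed (auto split: split_indicator)
    then show "(\<lambda>n. (\<integral>z. indicator (?S (X n)) z * ?g z \<partial>lborel) / 2) \<longlonglongrightarrow> (\<integral>z. ?g z \<partial>lborel) / 2"
      by (intro tendsto_divide tendsto_const) auto
  qed simp
  moreover have "\<forall>\<^sub>F \<epsilon> in at_right 0. (\<integral>z. indicator (?S \<epsilon>) z * ?g z \<partial>lborel) / 2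
      = (LINT z:?S \<epsilon>|lborel. (v (x + z) - v x) / norm z powr ?q)"
    using eventually_at_right_less[of 0] by eventually_elim (simp only: J)
  ultimately have "((\<lambda>\<epsilon>. LINT z:?S \<epsilon>|lborel. (v (x + z) - v x) / norm z powr ?q)
      \<longlongrightarrow> (\<integral>z. ?g z \<partial>lborel) / 2) (at_right 0)"
    by (rule Lim_transform_eventually)
  then show ?eq
    by (simp add: frac_laplacian_def tendsto_Lim)
qed


section \<open>Twice continuously differentiable functions\<close>

lemma C2_on_const: "C2_on S (\<lambda>x. k)"
  unfolding C2_on_def
  by (intro exI[of _ "\<lambda>x. 0"] conjI ballI)
    (auto intro!: has_derivative_eq_rhs[OF has_derivative_const] simp: fun_eq_iff)

lemma C2_on_add:
  assumes "C2_on S f" "C2_on S g"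
  shows "C2_on S (\<lambda>x. f x + g x)"
proof -
  from assms obtain D H D' H' where
    *: "\<And>x. x \<in> S \<Longrightarrow> (f has_derivative (\<lambda>h. D x \<bullet> h)) (at x)"
      "\<And>x. x \<in> S \<Longrightarrow> (D has_derivative (\<lambda>h. H x *v h)) (at x)"
      "continuous_on S H"
      "\<And>x. x \<in> S \<Longrightarrow> (g has_derivative (\<lambda>h. D' x \<bullet> h)) (at x)"
      "\<And>x. x \<in> S \<Longrightarrow> (D' has_derivative (\<lambda>h. H' x *v h)) (at x)"
      "continuous_on S H'"
    unfolding C2_on_def by blast
  show ?thesis
    unfolding C2_on_def
  proof (intro exI[of _ "\<lambda>x. D x + D' x"] exI[of _ "\<lambda>x. H x + H' x"] conjI ballI)
    fix x assume x: "x \<in> S"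
    show "((\<lambda>x. f x + g x) has_derivative (\<lambda>h. (D x + D' x) \<bullet> h)) (at x)"
      by (rule has_derivative_eq_rhs[OF has_derivative_add[OF *(1,4)[OF x]]])
        (simp add: fun_eq_iff inner_add_left)
    show "((\<lambda>x. D x + D' x) has_derivative (\<lambda>h. (H x + H' x) *v h)) (at x)"
      by (rule has_derivative_eq_rhs[OF has_derivative_add[OF *(2,5)[OF x]]])
        (simp add: fun_eq_iff matrix_vector_mult_add_rdistrib)
  qed (intro continuous_on_add *)
qed

lemma C2_on_cmult:
  assumes "C2_on S f"
  shows "C2_on S (\<lambda>x. k * f x)"
proof -
  from assms obtain D H where
    *: "\<And>x. x \<in> S \<Longrightarrow> (f has_derivative (\<lambda>h. D x \<bullet> h)) (at x)"
      "\<And>x. x \<in> S \<Longrightarrow> (D has_derivative (\<lambda>h. H x *v h)) (at x)"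
      "continuous_on S H"
    unfolding C2_on_def by blast
  show ?thesis
    unfolding C2_on_def
  proof (intro exI[of _ "\<lambda>x. k *\<^sub>R D x"] exI[of _ "\<lambda>x. k *\<^sub>R H x"] conjI ballI)
    fix x assume x: "x \<in> S"
    show "((\<lambda>x. k * f x) has_derivative (\<lambda>h. (k *\<^sub>R D x) \<bullet> h)) (at x)"
      by (rule has_derivative_eq_rhs[OF has_derivative_mult_right[OF *(1)[OF x]]])
        (simp add: fun_eq_iff)
    show "((\<lambda>x. k *\<^sub>R D x) has_derivative (\<lambda>h. (k *\<^sub>R H x) *v h)) (at x)"
      by (rule has_derivative_eq_rhs[OF has_derivative_scaleR_right[OF *(2)[OF x]]])
        (simp add: fun_eq_iff scaleR_matrix_vector_assoc[symmetric])
  qed (intro continuous_intros *)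
qed

text \<open>Covers both ingredients of the test functions: \<open>k = 0\<close> gives powers of the
  distance away from \<open>y\<close>, and \<open>k = R\<^sup>2\<close> gives the penalty on the
  whole space.\<close>

lemma C2_on_powr_norm:
  fixes y :: "real ^ 'n"
  assumes pos: "\<And>x. x \<in> S \<Longrightarrow> 0 < k + (norm (x - y))\<^sup>2"
  shows "C2_on S (\<lambda>x. (k + (norm (x - y))\<^sup>2) powr e)"
proof -
  let ?Q = "\<lambda>x. k + (x - y) \<bullet> (x - y)"
  define D where "D x = (2 * e * ?Q x powr (e - 1)) *\<^sub>R (x - y)" for x
  \<comment> \<open>A multiple of the identity from differentiating \<open>x - y\<close>, plus a
    rank-one matrix from differentiating the scalar factor of \<open>D\<close>.\<close>
  define H :: "real ^ 'n \<Rightarrow> real ^ 'n ^ 'n" where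
    "H x = (2 * e * ?Q x powr (e - 1)) *\<^sub>R mat 1
      + (4 * e * (e - 1) * ?Q x powr (e - 2)) *\<^sub>R (\<chi> i j. (x - y) $ i * (x - y) $ j)" for x
  have Q: "0 < ?Q x" if "x \<in> S" for x
    using pos[OF that] by (simp add: power2_norm_eq_inner)
  have dyad: "(\<chi> i j. w $ i * w $ j) *v h = (w \<bullet> h) *\<^sub>R w" for w h :: "real ^ 'n"
    by (simp add: vec_eq_iff matrix_vector_mult_def inner_vec_def sum_distrib_right sum_distrib_left mult_ac)
  have 1: "((\<lambda>x. ?Q x powr e) has_derivative (\<lambda>h. D x \<bullet> h)) (at x)" if "x \<in> S" for x
  proof -
    have "((\<lambda>x. ?Q x powr e) has_derivative
        (\<lambda>h. ?Q x powr e * (2 * ((x - y) \<bullet> h) * e / ?Q x))) (at x)"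
      using Q[OF that] by (auto intro!: derivative_eq_intros simp: inner_commute)
    then show ?thesis
    proof (rule has_derivative_eq_rhs)
      show "(\<lambda>h. ?Q x powr e * (2 * ((x - y) \<bullet> h) * e / ?Q x)) = (\<lambda>h. D x \<bullet> h)"
        using Q[OF that] by (simp add: D_def powr_diff fun_eq_iff)
    qed
  qed
  have 2: "(D has_derivative (\<lambda>h. H x *v h)) (at x)" if "x \<in> S" for x
  proof -
    have "((\<lambda>x. (2 * e * ?Q x powr (e - 1)) *\<^sub>R (x - y)) has_derivative
       (\<lambda>h. (2 * e * ?Q x powr (e - 1)) *\<^sub>R h
         + (2 * e * (?Q x powr (e - 1) * ((e - 1) * (2 * ((x - y) \<bullet> h)) / ?Q x))) *\<^sub>R (x - y))) (at x)"
      using Q[OF that]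
      by (auto intro!: derivative_eq_intros ext simp: inner_commute algebra_simps)
    also have "(\<lambda>h. (2 * e * ?Q x powr (e - 1)) *\<^sub>R h
         + (2 * e * (?Q x powr (e - 1) * ((e - 1) * (2 * ((x - y) \<bullet> h)) / ?Q x))) *\<^sub>R (x - y))
       = (\<lambda>h. H x *v h)"
    proof
      fix h
      have "?Q x powr (e - 2) = ?Q x powr (e - 1) / ?Q x"
        using Q[OF that] powr_diff[of "?Q x" "e - 1" 1] by (simp add: algebra_simps)
      then show "(2 * e * ?Q x powr (e - 1)) *\<^sub>R h
         + (2 * e * (?Q x powr (e - 1) * ((e - 1) * (2 * ((x - y) \<bullet> h)) / ?Q x))) *\<^sub>R (x - y) = H x *v h"
        by (simp add: H_def matrix_vector_mult_add_rdistrib scaleR_matrix_vector_assoc[symmetric] dyad del: vector_minus_component)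
    qed
    finally show ?thesis unfolding D_def .
  qed
  have 3: "continuous_on S H"
    unfolding H_def using Q
    by (intro continuous_intros continuous_on_vec_lambda) (auto simp: less_imp_neq[THEN not_sym])
  show ?thesis
    unfolding C2_on_def power2_norm_eq_inner using 1 2 3 by blast
qed

text \<open>The Hessian is bounded on a smaller closed ball, so the gradient is Lipschitz there. The
  mean value theorem for \<open>f (x + t *\<^sub>R z) + f (x - t *\<^sub>R z)\<close> turns the
  second difference into a difference of gradients at points \<open>2 * t * norm z\<close>
  apart.\<close>

lemma C2_on_second_diff_bound:
  fixes x :: "real ^ 'n"
  assumes C2: "C2_on (ball x r) f" and r: "0 < r"
  obtains K \<delta> where "0 < \<delta>" "\<delta> \<le> r" "\<And>z. norm z < \<delta> \<Longrightarrow> \<bar>second_diff f x z\<bar> \<le> K * (norm z)\<^sup>2"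
proof -
  from C2 obtain D H where
    f: "\<And>y. y \<in> ball x r \<Longrightarrow> (f has_derivative (\<lambda>h. D y \<bullet> h)) (at y)"
    and D: "\<And>y. y \<in> ball x r \<Longrightarrow> (D has_derivative (\<lambda>h. H y *v h)) (at y)"
    and H: "continuous_on (ball x r) H"
    unfolding C2_on_def by blast
  let ?C = "cball x (r/2)"
  have sub: "?C \<subseteq> ball x r" using r by auto
  \<comment> \<open>The entrywise sum dominates the operator norm of the Hessian and is visibly
    continuous, so it attains a maximum on the compact ball.\<close>
  let ?N = "\<lambda>y. \<Sum>i\<in>UNIV. \<Sum>j\<in>UNIV. \<bar>H y $ i $ j\<bar>"
  have "continuous_on ?C ?N"
    using continuous_on_subset[OF H sub] by (intro continuous_intros)
  moreover have "?C \<noteq> {}" using r by simp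
  ultimately obtain y0 where y0: "\<And>y. y \<in> ?C \<Longrightarrow> ?N y \<le> ?N y0"
    using continuous_attains_sup[OF compact_cball, of x "r/2" ?N] by blast
  define B where "B = ?N y0"
  have lip: "norm (D y - D y') \<le> B * norm (y - y')" if "y \<in> ?C" "y' \<in> ?C" for y y'
  proof (rule differentiable_bound[where S = ?C and f' = "\<lambda>w h. H w *v h"])
    show "(D has_derivative (*v) (H w)) (at w within ?C)" if "w \<in> ?C" for w
      by (rule has_derivative_at_withinI[OF D[OF subsetD[OF sub that]]])
    show "onorm ((*v) (H w)) \<le> B" if "w \<in> ?C" for w
      unfolding B_def by (rule order_trans[OF onorm_le_matrix_component_sum y0[OF that]])
  qed (use that in auto)
  have "0 \<le> B" unfolding B_def by (intro sum_nonneg) auto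
  show thesis
  proof (rule that[of "r/2" "2 * B"])
    fix z :: "real ^ 'n" assume z: "norm z < r / 2"
    have mem: "x + t *\<^sub>R z \<in> ?C" "x - t *\<^sub>R z \<in> ?C" if "0 \<le> t" "t \<le> 1" for t
      using z that mult_right_mono[of t 1 "norm z"] by (auto simp: dist_norm)
    let ?g = "\<lambda>t. f (x + t *\<^sub>R z) + f (x - t *\<^sub>R z)"
    have der: "(?g has_real_derivative (D (x + t *\<^sub>R z) \<bullet> z - D (x - t *\<^sub>R z) \<bullet> z)) (at t)"
      if "0 \<le> t" "t \<le> 1" for t
    proof -
      have "((\<lambda>t. f (x + t *\<^sub>R z)) has_derivative (\<lambda>h. D (x + t *\<^sub>R z) \<bullet> (h *\<^sub>R z))) (at t)"
        by (rule has_derivative_compose[where f = "\<lambda>t. x + t *\<^sub>R z", OF _ f[OF subsetD[OF sub mem(1)[OF that]]]]) (auto intro!: derivative_eq_intros)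
      moreover have "((\<lambda>t. f (x - t *\<^sub>R z)) has_derivative (\<lambda>h. D (x - t *\<^sub>R z) \<bullet> (- (h *\<^sub>R z)))) (at t)"
        by (rule has_derivative_compose[where f = "\<lambda>t. x - t *\<^sub>R z", OF _ f[OF subsetD[OF sub mem(2)[OF that]]]]) (auto intro!: derivative_eq_intros)
      ultimately have "(?g has_derivative (\<lambda>h. D (x + t *\<^sub>R z) \<bullet> (h *\<^sub>R z) + D (x - t *\<^sub>R z) \<bullet> (- (h *\<^sub>R z)))) (at t)"
        by (rule has_derivative_add)
      then show ?thesis
        unfolding has_field_derivative_def
        by (rule back_subst[of "\<lambda>F. (?g has_derivative F) (at t)"]) (auto simp: algebra_simps)
    qed
    obtain t where t: "0 < t" "t < 1" "?g 1 - ?g 0 = D (x + t *\<^sub>R z) \<bullet> z - D (x - t *\<^sub>R z) \<bullet> z"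
      using MVT2[of 0 1 ?g "\<lambda>t. D (x + t *\<^sub>R z) \<bullet> z - D (x - t *\<^sub>R z) \<bullet> z"] der by auto
    have "\<bar>second_diff f x z\<bar> = \<bar>(D (x + t *\<^sub>R z) - D (x - t *\<^sub>R z)) \<bullet> z\<bar>"
      using t(3) by (simp add: second_diff_def inner_diff_left)
    also have "\<dots> \<le> norm (D (x + t *\<^sub>R z) - D (x - t *\<^sub>R z)) * norm z"
      by (rule Cauchy_Schwarz_ineq2)
    also have "\<dots> \<le> (B * norm ((x + t *\<^sub>R z) - (x - t *\<^sub>R z))) * norm z"
      using t mem by (intro mult_right_mono lip) auto
    also have "(x + t *\<^sub>R z) - (x - t *\<^sub>R z) = (2 * t) *\<^sub>R z"
      by (simp add: scaleR_2[symmetric] algebra_simps)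
    also have "B * norm ((2 * t) *\<^sub>R z) * norm z = (2 * B * (norm z)\<^sup>2) * t"
      using t by (simp add: power2_eq_square)
    also have "\<dots> \<le> (2 * B * (norm z)\<^sup>2) * 1"
      using t \<open>0 \<le> B\<close> by (intro mult_left_mono) auto
    finally show "\<bar>second_diff f x z\<bar> \<le> 2 * B * (norm z)\<^sup>2" by simp
  qed (use r in auto)
qed


section \<open>Second differences of concave powers\<close>

text \<open>A concave power lies below its tangent at \<open>m\<close>: this is Young's inequality
  for \<open>t / m\<close> and 1, scaled by \<open>m powr \<theta>\<close>.\<close>

lemma powr_le_tangent:
  fixes t m \<theta> :: real
  assumes "0 \<le> \<theta>" "\<theta> \<le> 1" "0 < m" "0 \<le> t"
  shows "t powr \<theta> \<le> m powr \<theta> + \<theta> * m powr (\<theta> - 1) * (t - m)"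
proof (cases "t = 0")
  case True
  have "m powr (\<theta> - 1) * m = m powr \<theta>"
    using assms by (simp add: powr_diff)
  then have "m powr \<theta> + \<theta> * m powr (\<theta> - 1) * (t - m) = (1 - \<theta>) * m powr \<theta>"
    using True by (simp add: algebra_simps)
  moreover have "0 \<le> (1 - \<theta>) * m powr \<theta>" using assms by simp
  ultimately show ?thesis using True by simp
next
  case False
  have "(t / m) powr \<theta> * 1 powr (1 - \<theta>) \<le> \<theta> * (t / m) + (1 - \<theta>) * 1"
    using assms False by (intro Youngs_inequality_0) auto
  then have "(t / m) powr \<theta> * m powr \<theta> \<le> (\<theta> * (t / m) + (1 - \<theta>)) * m powr \<theta>"
    by (intro mult_right_mono) auto
  then show ?thesis
    using assms by (simp add: powr_divide powr_diff field_simps)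
qed

text \<open>A fraction \<open>w / (a + t)\<close> in the unit interval does not exceed its own
  \<open>\<theta>\<close>-th power; the fractions for \<open>a\<close> and \<open>t\<close> add up
  to 1.\<close>

lemma powr_add_le_add_powr:
  fixes a t \<theta> :: real
  assumes "0 \<le> \<theta>" "\<theta> \<le> 1" "0 \<le> a" "0 \<le> t"
  shows "(a + t) powr \<theta> \<le> a powr \<theta> + t powr \<theta>"
proof (cases "a + t = 0")
  case False
  then have pos: "0 < a + t" using assms by linarith
  have frac: "w * (a + t) powr \<theta> / (a + t) \<le> w powr \<theta>" if "0 \<le> w" "w \<le> a + t" for w
  proof (cases "w = 0")
    case False
    have "(w / (a + t)) powr 1 \<le> (w / (a + t)) powr \<theta>"
      using that pos False assms by (intro powr_mono') auto
    then show ?thesis using that pos False by (simp add: powr_divide field_simps)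
  qed simp
  have "(a + t) powr \<theta> = a * (a + t) powr \<theta> / (a + t) + t * (a + t) powr \<theta> / (a + t)"
    using pos by (simp add: add_divide_distrib[symmetric] distrib_right[symmetric])
  also have "\<dots> \<le> a powr \<theta> + t powr \<theta>"
    using frac[of a] frac[of t] assms by simp
  finally show ?thesis .
qed (use assms in auto)

text \<open>Concavity of \<open>t \<mapsto> t powr (b / 2)\<close> at the midpoint \<open>k + |x|\<^sup>2 + |z|\<^sup>2\<close> of
  \<open>k + |x \<plusminus> z|\<^sup>2\<close>.\<close>
lemma second_diff_powr_norm_le:
  fixes x z :: "'a::real_inner"
  assumes "0 \<le> k" "0 < b" "b \<le> 2"
  shows "second_diff (\<lambda>x. (k + (norm x)\<^sup>2) powr (b/2)) x z
    \<le> 2 * ((k + (norm x)\<^sup>2 + (norm z)\<^sup>2) powr (b/2) - (k + (norm x)\<^sup>2) powr (b/2))"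
proof -
  define m where "m = k + (norm x)\<^sup>2 + (norm z)\<^sup>2"
  have mid: "(k + (norm (x + z))\<^sup>2) + (k + (norm (x - z))\<^sup>2) = 2 * m"
    by (simp add: m_def power2_norm_eq_inner inner_simps)
  have "(k + (norm (x + z))\<^sup>2) powr (b/2) + (k + (norm (x - z))\<^sup>2) powr (b/2) \<le> 2 * m powr (b/2)"
  proof (cases "m = 0")
    case False
    have "0 \<le> m" using assms by (simp add: m_def)
    then have m: "0 < m" using False by simp
    \<comment> \<open>The slope of the tangent at \<open>m\<close>, used at both points. By the
      parallelogram law \<open>mid\<close> their deviations from \<open>m\<close> cancel.\<close>
    define c where "c = (b/2) * m powr (b/2 - 1)"
    have "(k + (norm (x + z))\<^sup>2) powr (b/2) \<le> m powr (b/2) + c * ((k + (norm (x + z))\<^sup>2) - m)"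
      "(k + (norm (x - z))\<^sup>2) powr (b/2) \<le> m powr (b/2) + c * ((k + (norm (x - z))\<^sup>2) - m)"
      unfolding c_def using assms m by (auto intro!: powr_le_tangent simp del: times_divide_eq_left)
    then have "(k + (norm (x + z))\<^sup>2) powr (b/2) + (k + (norm (x - z))\<^sup>2) powr (b/2)
        \<le> 2 * m powr (b/2) + c * ((k + (norm (x + z))\<^sup>2) + (k + (norm (x - z))\<^sup>2) - 2 * m)"
      by (simp add: algebra_simps)
    then show ?thesis unfolding mid by simp
  next
    case True
    then have "k = 0" "x = 0" "z = 0"
      using assms by (auto simp: m_def add_nonneg_eq_0_iff)
    then show ?thesis by simp
  qed
  then show ?thesis by (simp add: second_diff_def m_def)
qed

lemma powr_half_norm_sq: "((norm x)\<^sup>2) powr (b/2) = norm x powr b"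
proof (cases "x = 0")
  case False
  then have "(norm x)\<^sup>2 = norm x powr 2" by simp
  then show ?thesis by (simp only: powr_powr) simp
qed simp

text \<open>The tangent at \<open>(norm a)\<^sup>2\<close> bounds the increment. This crude estimate
  controls the test functions on a small ball, whose contribution vanishes with the radius.\<close>

lemma second_diff_norm_powr_le:
  fixes a z :: "'a::real_inner"
  assumes "0 < b" "b \<le> 2" "a \<noteq> 0"
  shows "second_diff (\<lambda>x. norm x powr b) a z \<le> 2 * norm a powr (b - 2) * (norm z)\<^sup>2"
proof -
  have "second_diff (\<lambda>x. norm x powr b) a z \<le> 2 * (((norm a)\<^sup>2 + (norm z)\<^sup>2) powr (b/2) - ((norm a)\<^sup>2) powr (b/2))"
    using second_diff_powr_norm_le[of 0 b a z] assms by (simp add: powr_half_norm_sq)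
  also have "\<dots> \<le> 2 * ((b/2) * ((norm a)\<^sup>2) powr (b/2 - 1) * (norm z)\<^sup>2)"
    using powr_le_tangent[of "b/2" "(norm a)\<^sup>2" "(norm a)\<^sup>2 + (norm z)\<^sup>2"] assms by simp
  also have "((norm a)\<^sup>2) powr (b/2 - 1) = norm a powr (b - 2)"
    using powr_half_norm_sq[of a "b - 2"] by (simp add: diff_divide_distrib)
  also have "2 * (b/2 * norm a powr (b - 2) * (norm z)\<^sup>2) = b * (norm a powr (b - 2) * (norm z)\<^sup>2)"
    by simp
  also have "\<dots> \<le> 2 * (norm a powr (b - 2) * (norm z)\<^sup>2)"
    using assms by (intro mult_right_mono) auto
  finally show ?thesis by simp
qed

text \<open>Being below both powers, the minimum meets the near and far bounds of
  \<open>integrable_levy\<close> simultaneously.\<close>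

definition cutoff :: "real \<Rightarrow> real \<Rightarrow> real" where
  "cutoff b r = min (r\<^sup>2) (r powr b)"

lemma cutoff_measurable [measurable]: "cutoff b \<in> borel_measurable borel"
  unfolding cutoff_def by measurable

text \<open>The increment of \<open>A powr (b/2)\<close> is bounded twice: by the tangent at
  \<open>A \<ge> R\<^sup>2\<close>, which gives the quadratic bound, and by subadditivity, which
  gives the power \<open>b\<close>.\<close>

lemma second_diff_bracket_le:
  fixes x z :: "'a::real_inner"
  assumes "0 < b" "b \<le> 2" "0 < R"
  shows "second_diff (\<lambda>x. (R\<^sup>2 + (norm x)\<^sup>2) powr (b/2)) x z \<le> 2 * R powr b * cutoff b (norm z / R)"
proof -
  define A where "A = R\<^sup>2 + (norm x)\<^sup>2"
  have A: "0 < A" "R\<^sup>2 \<le> A" using assms by (auto simp: A_def add_pos_nonneg)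
  have R2: "(R\<^sup>2) powr (b/2 - 1) = R powr b / R\<^sup>2"
  proof -
    have "(R\<^sup>2) powr (b/2 - 1) = R powr (2 * (b/2 - 1))"
    proof -
      have "R\<^sup>2 = R powr 2" using assms by simp
      then show ?thesis by (simp only: powr_powr)
    qed
    also have "\<dots> = R powr (b - 2)" by (simp add: algebra_simps)
    finally show ?thesis using assms by (simp add: powr_diff)
  qed
  have "(A + (norm z)\<^sup>2) powr (b/2) - A powr (b/2) \<le> (b/2) * A powr (b/2 - 1) * (norm z)\<^sup>2"
    using powr_le_tangent[of "b/2" A "A + (norm z)\<^sup>2"] assms A by simp
  also have "\<dots> \<le> 1 * (R\<^sup>2) powr (b/2 - 1) * (norm z)\<^sup>2"
    using assms A by (intro mult_right_mono mult_mono powr_mono2') auto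
  also have "\<dots> = R powr b * (norm z / R)\<^sup>2"
    unfolding R2 by (simp add: power_divide)
  finally have 1: "(A + (norm z)\<^sup>2) powr (b/2) - A powr (b/2) \<le> R powr b * (norm z / R)\<^sup>2" .
  have "(A + (norm z)\<^sup>2) powr (b/2) - A powr (b/2) \<le> ((norm z)\<^sup>2) powr (b/2)"
    using powr_add_le_add_powr[of "b/2" A "(norm z)\<^sup>2"] assms A by simp
  also have "\<dots> = R powr b * (norm z / R) powr b"
    using assms by (simp add: powr_half_norm_sq powr_divide)
  finally have 2: "(A + (norm z)\<^sup>2) powr (b/2) - A powr (b/2) \<le> R powr b * (norm z / R) powr b" .
  have "(A + (norm z)\<^sup>2) powr (b/2) - A powr (b/2) \<le> R powr b * cutoff b (norm z / R)"
    using 1 2 by (simp add: cutoff_def min_def)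
  then show ?thesis
    using second_diff_powr_norm_le[of "R\<^sup>2" b x z] assms by (simp add: A_def)
qed

text \<open>The \<open>itself\<close> argument carries the dimension, which the real arguments do
  not determine.\<close>

definition cutoff_mass :: "'n::finite itself \<Rightarrow> real \<Rightarrow> real \<Rightarrow> real" where
  "cutoff_mass _ s b = (\<integral>(z::real^'n). cutoff b (norm z) / norm z powr (real CARD('n) + 2 * s) \<partial>lborel)"

text \<open>Substituting \<open>z / R\<close> for \<open>z\<close>: the Jacobian and the homogeneity
  of the kernel combine to the factor \<open>R powr (- 2 * s)\<close>.\<close>

lemma
  fixes R :: real
  assumes s: "0 < s" "s < 1" and b: "b < 2 * s" and R: "0 < R"
  shows integrable_cutoff:
      "integrable lborel (\<lambda>z::real^'n. cutoff b (norm z / R) / norm z powr (real CARD('n) + 2 * s))" (is ?int)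
    and integral_cutoff:
      "(\<integral>(z::real^'n). cutoff b (norm z / R) / norm z powr (real CARD('n) + 2 * s) \<partial>lborel)
         = R powr (- 2 * s) * cutoff_mass TYPE('n) s b" (is ?eq)
proof -
  let ?q = "real CARD('n) + 2 * s"
  let ?f = "\<lambda>z::real^'n. cutoff b (norm z) / norm z powr ?q"
  have f: "integrable lborel ?f"
    by (rule integrable_levy[OF s b, where A = 1 and B = 1]) (auto simp: cutoff_def)
  have scale: "?f (0 + (1 / R) *\<^sub>R z) = R powr ?q * (cutoff b (norm z / R) / norm z powr ?q)" for z
    using R by (simp add: powr_divide)
  have fs: "integrable lborel (\<lambda>z. R powr ?q * (cutoff b (norm z / R) / norm (z::real^'n) powr ?q))"
    using lborel_integrable_affine[OF f, of "1/R" 0] R unfolding scale by simp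
  show ?int
    using fs R unfolding integrable_mult_left_iff by simp
  have "cutoff_mass TYPE('n) s b
      = \<bar>1 / R\<bar> ^ CARD('n) * (R powr ?q * (\<integral>(z::real^'n). cutoff b (norm z / R) / norm z powr ?q \<partial>lborel))"
    unfolding cutoff_mass_def using lborel_integral_affine[OF f, of "1/R" 0] R
    unfolding scale integral_mult_right_zero by simp
  also have "\<bar>1 / R\<bar> ^ CARD('n) * R powr ?q = R powr (2 * s)"
    using R by (simp add: powr_add powr_realpow power_one_over)
  then have "\<bar>1 / R\<bar> ^ CARD('n) * (R powr ?q * (\<integral>(z::real^'n). cutoff b (norm z / R) / norm z powr ?q \<partial>lborel))
     = R powr (2 * s) * (\<integral>(z::real^'n). cutoff b (norm z / R) / norm z powr ?q \<partial>lborel)"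
    by (simp only: mult.assoc[symmetric])
  finally show ?eq using R by (simp add: powr_minus field_simps)
qed

lemma integral_small_ball_tendsto_0:
  assumes s: "0 < s" "s < 1"
  shows "(\<lambda>k. \<integral>(z::real^'n). indicator (ball 0 (1 / real (Suc k))) z * ((norm z)\<^sup>2 / norm z powr (real CARD('n) + 2 * s)) \<partial>lborel)
           \<longlonglongrightarrow> 0"
    and integrable_small_ball: "0 < r \<Longrightarrow> r \<le> 1 \<Longrightarrow>
      integrable lborel (\<lambda>z::real^'n. indicator (ball 0 r) z * ((norm z)\<^sup>2 / norm z powr (real CARD('n) + 2 * s)))"
proof -
  let ?q = "real CARD('n) + 2 * s"
  let ?f = "\<lambda>r (z::real^'n). indicator (ball 0 r) z * ((norm z)\<^sup>2 / norm z powr ?q)"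
  have int: "integrable lborel (?f r)" if "0 < r" "r \<le> 1" for r
  proof -
    have "integrable lborel (\<lambda>z::real^'n. (indicator (ball 0 r) z * (norm z)\<^sup>2) / norm z powr ?q)"
      using that s by (intro integrable_levy[OF s, where A = 1 and B = 1 and b = 0])
        (auto split: split_indicator intro!: borel_measurable_times borel_measurable_indicator)
    then show ?thesis by simp
  qed
  then show "0 < r \<Longrightarrow> r \<le> 1 \<Longrightarrow> integrable lborel (?f r)" .
  have "(\<lambda>k. \<integral>z. ?f (1 / real (Suc k)) z \<partial>lborel) \<longlonglongrightarrow> (\<integral>(z::real^'n). 0 \<partial>lborel)"
  proof (rule integral_dominated_convergence[where w = "?f 1"])
    show "integrable lborel (?f 1)" by (rule int) auto
    show "AE z in lborel. (\<lambda>k. ?f (1 / real (Suc k)) z) \<longlonglongrightarrow> 0"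
    proof (rule AE_I2)
      fix z :: "real ^ 'n"
      show "(\<lambda>k. ?f (1 / real (Suc k)) z) \<longlonglongrightarrow> 0"
      proof (cases "z = 0")
        case False
        then have "\<forall>\<^sub>F k in sequentially. 1 / real (Suc k) < norm z"
          using LIMSEQ_inverse_real_of_nat by (intro order_tendstoD) (auto simp: inverse_eq_divide)
        then have "\<forall>\<^sub>F k in sequentially. ?f (1 / real (Suc k)) z = 0"
          by eventually_elim simp
        then show ?thesis by (rule tendsto_eventually)
      qed simp
    qed
    show "AE z in lborel. norm (?f (1 / real (Suc k)) z) \<le> ?f 1 z" for k
    proof (rule AE_I2)
      fix z :: "real ^ 'n"
      have "norm z < 1" if "norm z < 1 / real (Suc k)"
        by (rule order.strict_trans2[OF that]) simp
      then show "norm (?f (1 / real (Suc k)) z) \<le> ?f 1 z"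
        by (auto split: split_indicator)
    qed
    show "?f (1 / real (Suc k)) \<in> borel_measurable lborel" for k
      by (rule borel_measurable_integrable, rule int) auto
  qed simp
  then show "(\<lambda>k. \<integral>z. ?f (1 / real (Suc k)) z \<partial>lborel) \<longlonglongrightarrow> 0" by simp
qed


section \<open>Doubling of variables\<close>

lemma semicontinuous_imp_continuous_on:
  assumes "upper_semicontinuous u" "lower_semicontinuous u"
  shows "continuous_on UNIV u"
  unfolding continuous_on_def
proof
  fix x
  have "(u \<longlongrightarrow> u x) (at x)"
    using assms unfolding upper_semicontinuous_def lower_semicontinuous_def
    by (intro order_tendstoI) (auto simp: eventually_nhds_conv_at)
  then show "(u \<longlongrightarrow> u x) (at x within UNIV)" by simp
qed

text \<open>A globally continuous test function is bounded on the closed ball, so gluing it in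
  preserves integrability. This discharges the integrability condition on test functions in the
  viscosity definitions.\<close>

lemma in_L1_weight_glue:
  fixes u :: "real ^ 'n \<Rightarrow> real"
  assumes u: "in_L1_weight s u" and \<phi>: "continuous_on UNIV \<phi>"
  shows "in_L1_weight s (glue x r \<phi> u)"
proof -
  have pos: "1 + norm z \<noteq> 0" for z :: "real ^ 'n"
    using norm_ge_zero[of z] by linarith
  have "continuous_on (cball x r) (\<lambda>z. \<phi> z * weight s z)"
    \<comment> \<open>Integrability of continuous functions is available on compact sets, hence the
      closed ball first; the open one of \<open>glue\<close> is cut out of it afterwards.\<close>
    unfolding weight_def using continuous_on_subset[OF \<phi>] pos
    by (intro continuous_intros) auto
  then have "integrable lborel (\<lambda>z. indicator (cball x r) z *\<^sub>R (\<phi> z * weight s z))"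
    by (intro borel_integrable_compact compact_cball)
  then have "integrable lborel (\<lambda>z. indicator (ball x r) z *\<^sub>R (indicator (cball x r) z *\<^sub>R (\<phi> z * weight s z)))"
    by (rule integrable_mult_indicator[rotated]) simp
  moreover have "integrable lborel (\<lambda>z. indicator (- ball x r) z *\<^sub>R (u z * weight s z))"
    using u unfolding in_L1_weight_def by (rule integrable_mult_indicator[rotated]) simp
  ultimately have "integrable lborel (\<lambda>z. indicator (ball x r) z *\<^sub>R (indicator (cball x r) z *\<^sub>R (\<phi> z * weight s z))
      + indicator (- ball x r) z *\<^sub>R (u z * weight s z))"
    by (rule Bochner_Integration.integrable_add)
  then show ?thesis
    unfolding in_L1_weight_def
    by (rule back_subst[of "integrable lborel"]) (auto simp: glue_def fun_eq_iff split: split_indicator)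
qed

lemma second_diff_glue_near:
  "norm z < r \<Longrightarrow> second_diff (glue x r \<phi> u) x z = second_diff \<phi> x z"
  using order.strict_trans1[OF norm_ge_zero[of z], of r]
  by (auto simp: second_diff_def glue_def dist_norm)

lemma second_diff_glue_far:
  "r \<le> norm z \<Longrightarrow> \<phi> x = u x \<Longrightarrow> second_diff (glue x r \<phi> u) x z = second_diff u x z"
  by (auto simp: second_diff_def glue_def dist_norm)

text \<open>Near \<open>x\<close> the glued function is \<open>\<phi>\<close>, so the C2 bound
  supplies the quadratic estimate needed for the second-difference formula.\<close>

lemma
  fixes u :: "real ^ 'n \<Rightarrow> real"
  assumes s: "0 < s" "s < 1" and u: "in_L1_weight s u" and r: "0 < r"
    and \<phi>: "continuous_on UNIV \<phi>" "C2_on (ball x r) \<phi>"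
  shows integrable_second_diff_glue:
      "integrable lborel (\<lambda>z. second_diff (glue x r \<phi> u) x z / norm z powr (real CARD('n) + 2 * s))" (is ?int)
    and frac_laplacian_glue:
      "frac_laplacian c s (glue x r \<phi> u) x = - (c / 2) *
         (\<integral>z. second_diff (glue x r \<phi> u) x z / norm z powr (real CARD('n) + 2 * s) \<partial>lborel)" (is ?eq)
proof -
  obtain K \<delta> where K: "0 < \<delta>" "\<delta> \<le> r" "\<And>z. norm z < \<delta> \<Longrightarrow> \<bar>second_diff \<phi> x z\<bar> \<le> K * (norm z)\<^sup>2"
    using C2_on_second_diff_bound[OF \<phi>(2) r] by metis
  then have near: "\<bar>second_diff (glue x r \<phi> u) x z\<bar> \<le> K * (norm z)\<^sup>2" if "norm z < \<delta>" for z
    using that by (simp add: second_diff_glue_near)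
  note v = in_L1_weight_glue[OF u \<phi>(1), of x r]
  show ?int by (rule integrable_second_diff[OF s v K(1) near])
  show ?eq by (rule frac_laplacian_eq_second_diff[OF s v K(1) near])
qed

text \<open>The Ishii--Lions argument. Near the maximum point, \<open>L |x - y|\<^sup>b\<close> supplies test functions.
  Moving \<open>x\<close> and \<open>y\<close> together costs only \<open>P\<close>, whereas for \<open>z\<close> near \<open>a = x0 - y0\<close> moving them
  separately by \<open>z\<close> gains \<open>L \<sigma> |a|\<^sup>b\<close>, because \<open>|\<cdot>|\<^sup>b\<close> is strictly concave along \<open>a\<close>.\<close>
lemma doubling_estimate:
  fixes s :: real and u P M :: "real ^ 'n \<Rightarrow> real" and x0 y0 :: "real ^ 'n"
  defines "q \<equiv> real CARD('n) + 2 * s" and "a \<equiv> x0 - y0"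
  assumes c: "0 < c" and s: "0 < s" "s < 1" and p: "0 < p" and sol: "viscosity_solution c s p u"
    and b: "0 < b" "b \<le> 2" and L: "0 < L"
    and \<rho>: "0 < \<rho>" "\<rho> < 1" "(2 + \<rho>) powr b + \<rho> powr b \<le> 2 - \<sigma>" "0 \<le> \<sigma>"
    and P: "continuous_on UNIV P" "\<And>S. C2_on S P"
    and M: "integrable lborel (\<lambda>z. M z / norm z powr q)" "\<And>z. second_diff P x0 z \<le> M z"
    and max: "\<And>x y. u x - u y - L * norm (x - y) powr b - P x \<le> u x0 - u y0 - L * norm (x0 - y0) powr b - P x0"
    and less: "u y0 < u x0"
  shows "L * (\<sigma> * (1 + \<rho>) powr (- q) * measure lborel (ball (0::real^'n) 1) * \<rho> ^ CARD('n)) * norm a powr (b - 2 * s)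
    \<le> (\<integral>z. M z / norm z powr q \<partial>lborel)"
proof -
  have sub: "viscosity_subsolution c s p u" and super: "viscosity_supersolution c s p u"
    using sol by (auto simp: viscosity_solution_def)
  have L1: "in_L1_weight s u" and pos: "\<And>x. 0 < u x"
    using sub by (auto simp: viscosity_subsolution_def)
  have a: "0 < norm a" using less by (auto simp: a_def)
  have norms: "norm (x0 + z - y0) = norm (a + z)" "norm (x0 - z - y0) = norm (a - z)"
    "norm (y0 + z - x0) = norm (a - z)" "norm (y0 - z - x0) = norm (a + z)"
    "norm (y0 - x0) = norm a" "norm (x0 - y0) = norm a"
    "norm (x0 - (y0 + z)) = norm (a - z)" "norm (x0 - (y0 - z)) = norm (a + z)" for z
    using norm_minus_commute[of "y0 + z" x0] norm_minus_commute[of "y0 - z" x0] norm_minus_commute[of y0 x0]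
    by (auto simp: a_def algebra_simps)
  \<comment> \<open>Freezing \<open>y = y0\<close> in the maximality gives \<open>\<phi>\<close>,
    which touches \<open>u\<close> from above at \<open>x0\<close>; freezing \<open>x = x0\<close>
    gives \<open>\<psi>\<close>, which touches from below at \<open>y0\<close>.\<close>
  define \<phi> where "\<phi> x = (u x0 - L * norm a powr b - P x0) + (L * norm (x - y0) powr b + P x)" for x
  define \<psi> where "\<psi> y = (u y0 + L * norm a powr b) + (- L) * norm (y - x0) powr b" for y
  have cont_pow: "continuous_on UNIV (\<lambda>x. norm (x - w) powr b)" for w :: "real ^ 'n"
    using b by (intro continuous_on_powr' continuous_intros) auto
  have cont: "continuous_on UNIV \<phi>" "continuous_on UNIV \<psi>"
    unfolding \<phi>_def \<psi>_def by (intro continuous_intros cont_pow P)+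
  have C2_pow: "C2_on (ball v r) (\<lambda>x. norm (x - w) powr b)" if "norm (v - w) = norm a" "r \<le> norm a"
    for v w :: "real ^ 'n" and r
  proof -
    \<comment> \<open>The radius is at most the distance from the center to \<open>w\<close>, so the
      open ball avoids the singular point \<open>w\<close> of the power.\<close>
    have "0 < 0 + (norm (x - w))\<^sup>2" if "x \<in> ball v r" for x
      using that \<open>norm (v - w) = norm a\<close> \<open>r \<le> norm a\<close> by (auto simp: dist_norm)
    from C2_on_powr_norm[of "ball v r" 0 w "b/2", OF this] show ?thesis
      by (simp add: powr_half_norm_sq)
  qed
  have C2: "C2_on (ball x0 r) \<phi>" "C2_on (ball y0 r) \<psi>" if "r \<le> norm a" for r
    unfolding \<phi>_def \<psi>_def using that
    by (intro C2_on_add C2_on_const C2_on_cmult C2_pow P; simp add: norms)+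
  have touch: "u x0 = \<phi> x0" "u y0 = \<psi> y0" "u x \<le> \<phi> x" "\<psi> x \<le> u x" for x
    using max[of x y0] max[of x0 x] by (auto simp: \<phi>_def \<psi>_def norms norm_minus_commute)
  have sd\<phi>: "second_diff \<phi> x0 z = L * second_diff (\<lambda>x. norm x powr b) a z + second_diff P x0 z" for z
    unfolding second_diff_def \<phi>_def norms by (simp add: algebra_simps)
  have sd\<psi>: "second_diff \<psi> y0 z = - L * second_diff (\<lambda>x. norm x powr b) a z" for z
    unfolding second_diff_def \<psi>_def norms by (simp add: algebra_simps)
  let ?A = "ball a (\<rho> * norm a)"
  have transl: "second_diff u x0 z - second_diff u y0 z \<le> M z" for z
    using max[of "x0 + z" "y0 + z"] max[of "x0 - z" "y0 - z"] M(2)[of z]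
    by (simp add: second_diff_def norms)
  have gain: "second_diff u x0 z - second_diff u y0 z \<le> M z - L * \<sigma> * norm a powr b" if "z \<in> ?A" for z
  proof -
    have "norm (a - z) \<le> \<rho> * norm a"
      using that by (simp add: dist_norm)
    then have 1: "norm (a - z) powr b \<le> (\<rho> * norm a) powr b"
      using b by (intro powr_mono2) auto
    have "norm (a + z) \<le> norm (2 *\<^sub>R a) + norm (a - z)"
      using norm_triangle_ineq4[of "2 *\<^sub>R a" "a - z"] by (simp add: scaleR_2)
    then have "norm (a + z) \<le> (2 + \<rho>) * norm a"
      using \<open>norm (a - z) \<le> \<rho> * norm a\<close> by (simp add: algebra_simps)
    then have "norm (a + z) powr b \<le> ((2 + \<rho>) * norm a) powr b"
      using b by (intro powr_mono2) auto
    with 1 have "norm (a + z) powr b + norm (a - z) powr b \<le> ((2 + \<rho>) powr b + \<rho> powr b) * norm a powr b"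
    proof -
      have "((2 + \<rho>) * norm a) powr b = (2 + \<rho>) powr b * norm a powr b"
        "(\<rho> * norm a) powr b = \<rho> powr b * norm a powr b"
        using \<rho> by (auto simp: powr_mult)
      then show ?thesis
        using 1 \<open>norm (a + z) powr b \<le> _\<close> by (simp only: distrib_right)
    qed
    also have "\<dots> \<le> (2 - \<sigma>) * norm a powr b"
      using \<rho> by (intro mult_right_mono) auto
    finally have "L * (norm (a + z) powr b + norm (a - z) powr b) \<le> L * ((2 - \<sigma>) * norm a powr b)"
      using L by (intro mult_left_mono) auto
    \<comment> \<open>Three comparisons are added: \<open>x\<close> alone moved by \<open>z\<close>,
      \<open>y\<close> alone moved by \<open>z\<close>, and both moved by \<open>- z\<close>. The
      \<open>L\<close>-terms then form the second difference of the power at \<open>a\<close>, where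
      \<open>a - z\<close> is short and \<open>a + z\<close> is about twice as long as
      \<open>a\<close>.\<close>
    then show ?thesis
      using max[of "x0 + z" y0] max[of x0 "y0 + z"] max[of "x0 - z" "y0 - z"] M(2)[of z]
      by (simp add: second_diff_def norms algebra_simps)
  qed
  let ?B = "\<lambda>r z. indicator (ball 0 r) z * ((norm (z::real^'n))\<^sup>2 / norm z powr q)"
  \<comment> \<open>The gain times the smallest value of the kernel on \<open>?A\<close>, since
    \<open>norm z \<le> (1 + \<rho>) * norm a\<close> there.\<close>
  let ?g = "L * \<sigma> * norm a powr b * ((1 + \<rho>) * norm a) powr (- q)"
  have qpos: "0 < q" using s by (simp add: q_def)
  have content_A: "measure lborel ?A = measure lborel (ball (0::real^'n) 1) * (\<rho> * norm a) ^ CARD('n)"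
    using content_ball_conv_unit_ball[of "\<rho> * norm a" a] \<rho> by simp
  have int_A: "integrable lborel (\<lambda>z. ?g * indicator ?A z :: real)"
    by (intro integrable_mult_right integrable_real_indicator emeasure_lborel_ball_finite) auto
  have main: "?g * measure lborel ?A
      \<le> 4 * L * norm a powr (b - 2) * (\<integral>z. ?B r z \<partial>lborel) + (\<integral>z. M z / norm z powr q \<partial>lborel)"
    \<comment> \<open>The last condition keeps \<open>?A\<close> outside the ball of radius
      \<open>r\<close>, so on \<open>?A\<close> the glued functions have the second differences of
      \<open>u\<close> itself.\<close>
    if r: "0 < r" "r \<le> 1" "r \<le> (1 - \<rho>) * norm a" for r
  proof -
    have ra: "r \<le> norm a"
    proof -
      have "(1 - \<rho>) * norm a \<le> 1 * norm a" using \<rho>(1) by (intro mult_right_mono) auto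
      with r(3) show ?thesis by linarith
    qed
    let ?v = "glue x0 r \<phi> u" and ?w = "glue y0 r \<psi> u"
    let ?I = "\<lambda>z. second_diff ?v x0 z / norm z powr q" and ?J = "\<lambda>z. second_diff ?w y0 z / norm z powr q"
    have int: "integrable lborel ?I" "integrable lborel ?J"
      unfolding q_def using integrable_second_diff_glue[OF s L1 r(1)] cont C2[OF ra] by auto
    have "frac_laplacian c s ?v x0 \<le> u x0 powr (- p)"
      using sub r(1) C2(1)[OF ra] touch in_L1_weight_glue[OF L1 cont(1)]
      unfolding viscosity_subsolution_def by blast
    also have "\<dots> \<le> u y0 powr (- p)"
      using less pos[of y0] p by (intro powr_mono2') auto
    also have "\<dots> \<le> frac_laplacian c s ?w y0"
      using super r(1) C2(2)[OF ra] touch in_L1_weight_glue[OF L1 cont(2)]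
      unfolding viscosity_supersolution_def by blast
    finally have "- (c / 2) * (\<integral>z. ?I z \<partial>lborel) \<le> - (c / 2) * (\<integral>z. ?J z \<partial>lborel)"
      using frac_laplacian_glue[OF s L1 r(1) cont(1) C2(1)[OF ra], of c]
        frac_laplacian_glue[OF s L1 r(1) cont(2) C2(2)[OF ra], of c]
      by (simp add: q_def)
    then have "(\<integral>z. ?J z \<partial>lborel) \<le> (\<integral>z. ?I z \<partial>lborel)"
      using c by (simp add: mult_le_cancel_left)
    then have "0 \<le> (\<integral>z. ?I z - ?J z \<partial>lborel)"
      using int by (simp add: Bochner_Integration.integral_diff)
    also have "\<dots> \<le> (\<integral>z. 4 * L * norm a powr (b - 2) * ?B r z + M z / norm z powr q - ?g * indicator ?A z \<partial>lborel)"
    proof (rule integral_mono)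
      show "integrable lborel (\<lambda>z. ?I z - ?J z)" using int by (rule Bochner_Integration.integrable_diff)
      show "integrable lborel (\<lambda>z. 4 * L * norm a powr (b - 2) * ?B r z + M z / norm z powr q - ?g * indicator ?A z)"
        using integrable_small_ball[OF s r(1,2), where 'n = 'n] M(1) int_A unfolding q_def
        by (intro Bochner_Integration.integrable_diff Bochner_Integration.integrable_add integrable_mult_right) auto
      fix z :: "real ^ 'n"
      have A_far: "r \<le> norm z \<and> norm z \<le> (1 + \<rho>) * norm a" if "z \<in> ?A"
        using that r(3) norm_triangle_ineq2[of a z] norm_triangle_ineq2[of z a]
        by (simp add: dist_norm norm_minus_commute algebra_simps)
      show "?I z - ?J z \<le> 4 * L * norm a powr (b - 2) * ?B r z + M z / norm z powr q - ?g * indicator ?A z"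
      proof (cases "norm z < r")
        case True
        have "second_diff ?v x0 z - second_diff ?w y0 z
            \<le> 4 * L * norm a powr (b - 2) * (norm z)\<^sup>2 + M z"
        proof -
          have "2 * L * second_diff (\<lambda>x. norm x powr b) a z \<le> 2 * L * (2 * norm a powr (b - 2) * (norm z)\<^sup>2)"
            using a L by (intro mult_left_mono second_diff_norm_powr_le b) auto
          \<comment> \<open>The factor 2 arises because the power enters \<open>\<phi>\<close> and
            \<open>\<psi>\<close> with opposite signs and the two second differences are
            subtracted.\<close>
          moreover have "second_diff ?v x0 z - second_diff ?w y0 z
              = 2 * L * second_diff (\<lambda>x. norm x powr b) a z + second_diff P x0 z"
            using True by (simp add: second_diff_glue_near sd\<phi> sd\<psi>)
          moreover have "2 * L * (2 * norm a powr (b - 2) * (norm z)\<^sup>2) = 4 * L * norm a powr (b - 2) * (norm z)\<^sup>2"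
            by simp
          ultimately show ?thesis using M(2)[of z] by linarith
        qed
        then have "(second_diff ?v x0 z - second_diff ?w y0 z) / norm z powr q
            \<le> (4 * L * norm a powr (b - 2) * (norm z)\<^sup>2 + M z) / norm z powr q"
          by (intro divide_right_mono) auto
        moreover have "z \<notin> ?A" using A_far True by auto
        ultimately show ?thesis
          using True by (simp add: add_divide_distrib diff_divide_distrib)
      next
        case False
        have eq: "?I z - ?J z = (second_diff u x0 z - second_diff u y0 z) / norm z powr q"
          using False touch by (simp add: second_diff_glue_far diff_divide_distrib)
        show ?thesis
        proof (cases "z \<in> ?A")
          case True
          have z: "0 < norm z" using False r(1) by linarith
          have "?g \<le> L * \<sigma> * norm a powr b * norm z powr (- q)"
            using A_far[OF True] z L \<rho> qpos by (intro mult_left_mono powr_mono2') auto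
          moreover have "?I z - ?J z \<le> (M z - L * \<sigma> * norm a powr b) / norm z powr q"
            unfolding eq by (intro divide_right_mono gain True) auto
          ultimately show ?thesis
            using True False by (simp add: powr_minus divide_inverse left_diff_distrib)
        next
          case nA: False
          have "?I z - ?J z \<le> M z / norm z powr q"
            unfolding eq by (intro divide_right_mono transl) auto
          then show ?thesis using nA False by simp
        qed
      qed
    qed
    also have "\<dots> = 4 * L * norm a powr (b - 2) * (\<integral>z. ?B r z \<partial>lborel) + (\<integral>z. M z / norm z powr q \<partial>lborel)
        - ?g * measure lborel ?A"
    proof -
      have B: "integrable lborel (\<lambda>z. 4 * L * norm a powr (b - 2) * ?B r z)"
        using integrable_small_ball[OF s r(1,2), where 'n = 'n] unfolding q_def
        by (intro integrable_mult_right) auto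
      have "(\<integral>z. 4 * L * norm a powr (b - 2) * ?B r z + M z / norm z powr q - ?g * indicator ?A z \<partial>lborel)
        = (\<integral>z. 4 * L * norm a powr (b - 2) * ?B r z \<partial>lborel) + (\<integral>z. M z / norm z powr q \<partial>lborel)
          - (\<integral>z. ?g * indicator ?A z \<partial>lborel)"
        using B M(1) int_A
        by (simp only: Bochner_Integration.integral_diff Bochner_Integration.integral_add
            Bochner_Integration.integrable_add)
      then show ?thesis
        by (simp only: integral_mult_right_zero) simp
    qed
    finally show ?thesis by linarith
  qed
  have "?g * measure lborel ?A \<le> (\<integral>z. M z / norm z powr q \<partial>lborel)"
  \<comment> \<open>Letting \<open>r = 1 / real (Suc k)\<close> tend to 0 removes the contribution
    of the small ball; the left-hand side does not depend on \<open>r\<close>.\<close>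
  proof (rule LIMSEQ_le_const)
    have "(\<lambda>k. 4 * L * norm a powr (b - 2) * (\<integral>z. ?B (1 / real (Suc k)) z \<partial>lborel)
        + (\<integral>z. M z / norm z powr q \<partial>lborel))
      \<longlonglongrightarrow> 4 * L * norm a powr (b - 2) * 0 + (\<integral>z. M z / norm z powr q \<partial>lborel)"
      unfolding q_def by (intro tendsto_intros integral_small_ball_tendsto_0 s)
    then show "(\<lambda>k. 4 * L * norm a powr (b - 2) * (\<integral>z. ?B (1 / real (Suc k)) z \<partial>lborel)
        + (\<integral>z. M z / norm z powr q \<partial>lborel)) \<longlonglongrightarrow> (\<integral>z. M z / norm z powr q \<partial>lborel)"
      by simp
    have "0 < (1 - \<rho>) * norm a" using \<rho> a by simp
    then have "\<forall>\<^sub>F k in sequentially. 1 / real (Suc k) < (1 - \<rho>) * norm a"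
      using LIMSEQ_inverse_real_of_nat by (intro order_tendstoD) (auto simp: inverse_eq_divide)
    then obtain N where N: "\<And>k. N \<le> k \<Longrightarrow> 1 / real (Suc k) < (1 - \<rho>) * norm a"
      unfolding eventually_sequentially by blast
    show "\<exists>N. \<forall>k\<ge>N. ?g * measure lborel ?A
      \<le> 4 * L * norm a powr (b - 2) * (\<integral>z. ?B (1 / real (Suc k)) z \<partial>lborel) + (\<integral>z. M z / norm z powr q \<partial>lborel)"
    proof (intro exI allI impI main)
      fix k assume "N \<le> k"
      then show "1 / real (Suc k) \<le> (1 - \<rho>) * norm a" using N by (simp add: less_imp_le)
    qed auto
  qed
  moreover have "?g * measure lborel ?A
    = L * (\<sigma> * (1 + \<rho>) powr (- q) * measure lborel (ball (0::real^'n) 1) * \<rho> ^ CARD('n)) * norm a powr (b - 2 * s)"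
  proof -
    have "norm a powr b * norm a powr (- q) * norm a ^ CARD('n) = norm a powr (b - 2 * s)"
    proof -
      have "norm a ^ CARD('n) = norm a powr CARD('n)" using a by (rule powr_realpow[symmetric])
      then show ?thesis by (simp only: powr_add[symmetric]) (simp add: q_def)
    qed
    then show ?thesis
      using \<rho> by (simp add: content_A powr_mult power_mult_distrib)
  qed
  ultimately show ?thesis by simp
qed


section \<open>The Liouville theorem\<close>

text \<open>Since \<open>2 powr b < 2\<close>, there is a gap \<open>d\<close>. Subadditivity costs
  two copies of \<open>\<rho> powr b\<close>, each at most \<open>d / 4\<close>, which leaves
  \<open>d / 2\<close>.\<close>

lemma strict_concavity_constants:
  fixes b :: real
  assumes "0 < b" "b < 1"
  obtains \<rho> \<sigma> where "0 < \<rho>" "\<rho> < 1" "0 < \<sigma>" "(2 + \<rho>) powr b + \<rho> powr b \<le> 2 - \<sigma>"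
proof
  define d where "d = 2 - 2 powr b"
  have "2 powr b < 2 powr (1::real)" using assms by (intro powr_less_mono) auto
  then have d: "0 < d" by (simp add: d_def)
  define \<rho> where "\<rho> = min (1/2) ((d/4) powr (1/b))"
  show \<rho>: "0 < \<rho>" "\<rho> < 1" using d by (auto simp: \<rho>_def)
  show "0 < d / 2" using d by simp
  have "\<rho> powr b \<le> ((d/4) powr (1/b)) powr b"
    using \<rho> assms by (intro powr_mono2) (auto simp: \<rho>_def)
  also have "\<dots> = d / 4" using d assms by (simp add: powr_powr)
  finally have "\<rho> powr b \<le> d / 4" .
  moreover have "(2 + \<rho>) powr b \<le> 2 powr b + \<rho> powr b"
    using assms \<rho> by (intro powr_add_le_add_powr) auto
  ultimately show "(2 + \<rho>) powr b + \<rho> powr b \<le> 2 - d / 2"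
    using d_def by linarith
qed

text \<open>This is \<open>R\<^sup>g \<eta> (x / R)\<close>, with the powers of \<open>R\<close> moved out of the bracket.\<close>
definition penalty :: "real \<Rightarrow> real \<Rightarrow> real \<Rightarrow> 'a::real_normed_vector \<Rightarrow> real" where
  "penalty g b R x = R powr (g - b) * ((R\<^sup>2 + (norm x)\<^sup>2) powr (b/2) - R powr b)"

lemma powr_le_bracket:
  assumes "0 < b"
  shows "\<bar>R\<bar> powr b \<le> (R\<^sup>2 + (norm x)\<^sup>2) powr (b/2)" "norm x powr b \<le> (R\<^sup>2 + (norm x)\<^sup>2) powr (b/2)"
  using assms powr_mono2[of "b/2" "R\<^sup>2" "R\<^sup>2 + (norm x)\<^sup>2"] powr_mono2[of "b/2" "(norm x)\<^sup>2" "R\<^sup>2 + (norm x)\<^sup>2"]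
    powr_half_norm_sq[of R b]
  by (auto simp: powr_half_norm_sq)

lemma penalty_nonneg:
  assumes "0 < b" "0 < R"
  shows "0 \<le> penalty g b R x"
  using powr_le_bracket(1)[of b R x] assms by (simp add: penalty_def)

text \<open>Tangent at \<open>R\<^sup>2\<close>. For fixed \<open>x\<close> and \<open>g < 2\<close>
  the penalty therefore vanishes as \<open>R\<close> grows, which keeps the maximum
  positive.\<close>

lemma penalty_le:
  assumes "0 < b" "b \<le> 2" "0 < R"
  shows "penalty g b R x \<le> R powr (g - 2) * (norm x)\<^sup>2"
proof -
  have "(R\<^sup>2 + (norm x)\<^sup>2) powr (b/2) \<le> (R\<^sup>2) powr (b/2) + (b/2) * (R\<^sup>2) powr (b/2 - 1) * (norm x)\<^sup>2"
    using powr_le_tangent[of "b/2" "R\<^sup>2" "R\<^sup>2 + (norm x)\<^sup>2"] assms by simp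
  also have "(R\<^sup>2) powr (b/2) = R powr b" using powr_half_norm_sq[of R b] assms by simp
  also have "(R\<^sup>2) powr (b/2 - 1) = R powr (b - 2)"
    using powr_half_norm_sq[of R "b - 2"] assms by (simp add: diff_divide_distrib)
  also have "b / 2 * R powr (b - 2) * (norm x)\<^sup>2 \<le> 1 * R powr (b - 2) * (norm x)\<^sup>2"
    using assms by (intro mult_right_mono) auto
  finally have "(R\<^sup>2 + (norm x)\<^sup>2) powr (b/2) - R powr b \<le> R powr (b - 2) * (norm x)\<^sup>2" by simp
  then have "penalty g b R x \<le> R powr (g - b) * (R powr (b - 2) * (norm x)\<^sup>2)"
    unfolding penalty_def by (rule mult_left_mono) simp
  also have "\<dots> = R powr (g - 2) * (norm x)\<^sup>2"
    by (simp add: mult.assoc[symmetric] powr_add[symmetric])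
  finally show ?thesis .
qed

text \<open>In terms of \<open>t = norm x / R\<close> the penalty is at least
  \<open>R powr g * (t powr b - 1)\<close>, while the growth bound is at most
  \<open>2 * C * R powr g * t powr g\<close>. As \<open>g < b\<close>, this bounds \<open>t\<close>
  independently of \<open>R\<close>.\<close>

lemma penalty_less_imp_norm_le:
  assumes g: "0 < g" "g < b" "g \<le> 1" and R: "1 \<le> R" and C: "0 < C"
    and less: "penalty g b R x < C * (1 + norm x) powr g"
  shows "norm x \<le> (1 + 2 * C) powr (1 / (b - g)) * R"
proof (rule ccontr)
  define K where "K = (1 + 2 * C) powr (1 / (b - g))"
  assume "\<not> norm x \<le> (1 + 2 * C) powr (1 / (b - g)) * R"
  then have big: "K * R < norm x" by (simp add: K_def)
  define t where "t = norm x / R"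
  have "1 \<le> K" unfolding K_def using C g by (intro ge_one_powr_ge_zero) auto
  have "K < t" using big R by (simp add: t_def field_simps)
  then have t: "1 < t" using \<open>1 \<le> K\<close> by simp
  have x: "norm x = t * R" using R by (simp add: t_def)
  have "R powr g * (t powr b - 1) = R powr (g - b) * (norm x powr b - R powr b)"
    using t R by (simp add: x powr_mult powr_diff field_simps)
  also have "\<dots> \<le> penalty g b R x"
    unfolding penalty_def using powr_le_bracket(2)[of b x R] g by (intro mult_left_mono) auto
  also note less
  also have "C * (1 + norm x) powr g \<le> C * (2 * (t powr g * R powr g))"
  proof (rule mult_left_mono)
    have "1 * 1 \<le> t * R" using t R by (intro mult_mono) auto
    then have "(1 + norm x) powr g \<le> (2 * (t * R)) powr g"
      using g by (intro powr_mono2) (auto simp: x mult.commute)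
    also have "\<dots> = 2 powr g * (t powr g * R powr g)"
      using t R by (simp add: powr_mult)
    also have "\<dots> \<le> 2 powr 1 * (t powr g * R powr g)"
      using g by (intro mult_right_mono powr_mono) auto
    finally show "(1 + norm x) powr g \<le> 2 * (t powr g * R powr g)" by simp
  qed (use C in simp)
  also have "\<dots> = R powr g * (2 * C * t powr g)" by simp
  finally have "t powr b - 1 < 2 * C * t powr g" using R by simp
  \<comment> \<open>This absorbs the 1 subtracted on the left into a multiple of
    \<open>t powr g\<close>.\<close>
  moreover have "1 \<le> t powr g" using t g by (intro ge_one_powr_ge_zero) auto
  ultimately have "t powr b < (1 + 2 * C) * t powr g" by (simp add: algebra_simps)
  then have "t powr (b - g) < 1 + 2 * C"
    using t by (simp add: powr_diff field_simps)
  moreover have "K powr (b - g) \<le> t powr (b - g)"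
    using \<open>K < t\<close> \<open>1 \<le> K\<close> g by (intro powr_mono2) auto
  moreover have "K powr (b - g) = 1 + 2 * C"
    using C g by (simp add: K_def powr_powr)
  ultimately show False by simp
qed

lemma continuous_on_penalty:
  assumes "0 < R"
  shows "continuous_on UNIV (penalty g b R :: 'a::real_normed_vector \<Rightarrow> real)"
proof -
  have "R\<^sup>2 + (norm x)\<^sup>2 \<noteq> 0" for x :: 'a
    using assms by (simp add: add_pos_nonneg less_imp_neq[THEN not_sym])
  then show ?thesis
    unfolding penalty_def by (intro continuous_intros) auto
qed

lemma C2_on_penalty:
  assumes "0 < R"
  shows "C2_on S (penalty g b R)"
proof -
  have "C2_on S (\<lambda>x. (R\<^sup>2 + (norm (x - 0))\<^sup>2) powr (b/2))"
    using assms by (intro C2_on_powr_norm) (simp add: add_pos_nonneg)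
  then have "C2_on S (\<lambda>x. R powr (g - b) * ((R\<^sup>2 + (norm (x - 0))\<^sup>2) powr (b/2) + - (R powr b)))"
    by (intro C2_on_cmult C2_on_add C2_on_const)
  then show ?thesis by (simp add: penalty_def[abs_def])
qed

lemma second_diff_penalty_le:
  fixes x z :: "'a::real_inner"
  assumes "0 < b" "b \<le> 2" "0 < R"
  shows "second_diff (penalty g b R) x z \<le> 2 * R powr g * cutoff b (norm z / R)"
proof -
  have "second_diff (penalty g b R) x z
      = R powr (g - b) * second_diff (\<lambda>x. (R\<^sup>2 + (norm x)\<^sup>2) powr (b/2)) x z"
    by (simp add: second_diff_def penalty_def algebra_simps)
  also have "\<dots> \<le> R powr (g - b) * (2 * R powr b * cutoff b (norm z / R))"
    using assms by (intro mult_left_mono second_diff_bracket_le) auto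
  also have "\<dots> = 2 * (R powr (g - b) * R powr b) * cutoff b (norm z / R)" by simp
  also have "R powr (g - b) * R powr b = R powr g" by (simp add: powr_add[symmetric])
  finally show ?thesis by simp
qed

text \<open>Positivity of \<open>u\<close> and its growth bound confine the points with
  \<open>?\<Phi> x y > 0\<close> to a compact set. The maximum over that set is positive, hence
  global.\<close>

lemma doubling_max_exists:
  fixes u :: "'a::euclidean_space \<Rightarrow> real"
  assumes g: "0 < g" "g < b" "g \<le> 1" and R: "1 \<le> R" and C: "0 < C" and L: "0 < L"
    and u: "continuous_on UNIV u" "\<And>x. 0 < u x" "\<And>x. u x \<le> C * (1 + norm x) powr g"
    and pos: "0 < u x1 - u y1 - L * norm (x1 - y1) powr b - penalty g b R x1"
  obtains x0 y0 where
    "\<And>x y. u x - u y - L * norm (x - y) powr b - penalty g b R x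
       \<le> u x0 - u y0 - L * norm (x0 - y0) powr b - penalty g b R x0"
    "u y0 < u x0"
    "norm (x0 - y0) powr b
       \<le> C * (1 + (1 + 2 * C) powr (1 / (b - g)) * R) powr g / L"
proof -
  let ?\<Phi> = "\<lambda>x y. u x - u y - L * norm (x - y) powr b - penalty g b R x"
  define K where "K = (1 + 2 * C) powr (1 / (b - g))"
  define B where "B = C * (1 + K * R) powr g / L"
  have b: "0 < b" using g by simp
  have K: "0 \<le> K" by (simp add: K_def)
  have bound: "norm x \<le> K * R \<and> norm (x - y) powr b \<le> B \<and> u y < u x" if "0 < ?\<Phi> x y" for x y
  proof (intro conjI)
    have pen: "0 \<le> penalty g b R x" using b R by (intro penalty_nonneg) auto
    have Lb: "0 \<le> L * norm (x - y) powr b" using L by simp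
    have "penalty g b R x < u x" using that u(2)[of y] Lb by linarith
    then show x: "norm x \<le> K * R"
      unfolding K_def using u(3)[of x] by (intro penalty_less_imp_norm_le g R C) auto
    have "L * norm (x - y) powr b \<le> u x" using that u(2)[of y] pen by linarith
    also have "\<dots> \<le> C * (1 + norm x) powr g" by (rule u(3))
    also have "\<dots> \<le> C * (1 + K * R) powr g"
      using C x g by (intro mult_left_mono powr_mono2) auto
    finally show "norm (x - y) powr b \<le> B" using L by (simp add: B_def field_simps)
    show "u y < u x" using that pen Lb by linarith
  qed
  let ?S = "cball (0::'a) (K * R) \<times> cball (0::'a) (K * R + B powr (1 / b))"
  have inS: "(x, y) \<in> ?S" if "0 < ?\<Phi> x y" for x y
  proof -
    have "norm (x - y) = (norm (x - y) powr b) powr (1 / b)" using b by (simp add: powr_powr)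
    also have "\<dots> \<le> B powr (1 / b)" using bound[OF that] b by (intro powr_mono2) auto
    finally have "norm y \<le> norm x + B powr (1 / b)"
      using norm_triangle_ineq2[of y x] by (simp add: norm_minus_commute)
    then show ?thesis using bound[OF that] by simp
  qed
  have "continuous_on UNIV (\<lambda>w::'a \<times> 'a. ?\<Phi> (fst w) (snd w))"
    using R b
    by (intro continuous_intros continuous_on_powr' continuous_on_compose2[OF u(1)]
        continuous_on_compose2[OF continuous_on_penalty]) auto
  then have "continuous_on ?S (\<lambda>w. ?\<Phi> (fst w) (snd w))"
    by (rule continuous_on_subset) simp
  moreover have "compact ?S" by (intro compact_Times compact_cball)
  moreover have "?S \<noteq> {}" using inS[OF pos] by blast
  ultimately obtain w where w: "w \<in> ?S" "\<And>v. v \<in> ?S \<Longrightarrow> ?\<Phi> (fst v) (snd v) \<le> ?\<Phi> (fst w) (snd w)"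
    using continuous_attains_sup[of ?S "\<lambda>w. ?\<Phi> (fst w) (snd w)"] by blast
  have w1: "0 < ?\<Phi> (fst w) (snd w)"
    using w(2)[OF inS[OF pos]] pos by simp
  have max: "?\<Phi> x y \<le> ?\<Phi> (fst w) (snd w)" for x y
    using w(2)[OF inS[of x y]] w1 by (cases "0 < ?\<Phi> x y") auto
  show thesis
    using that[of "fst w" "snd w"] max bound[OF w1] unfolding B_def K_def by blast
qed

text \<open>The two points are arbitrary, so exchanging them yields constancy.\<close>

lemma viscosity_solution_growth_imp_le:
  fixes u :: "real ^ 'n \<Rightarrow> real"
  assumes c: "0 < c" and s: "0 < s" "s < 1" and p: "0 < p" and sol: "viscosity_solution c s p u"
    and g: "0 < g" "g < 1" "g < 2 * s"
    and C: "0 < C" and growth: "\<And>x. u x \<le> C * (1 + norm x) powr g"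
  shows "u x1 \<le> u y1"
proof (rule ccontr)
  assume "\<not> u x1 \<le> u y1"
  \<comment> \<open>Strictly above \<open>g\<close> for coercivity of the penalty, below 1 for
    strict concavity of the power, and below \<open>2 * s\<close> for integrability of the cutoff at
    infinity.\<close>
  define b where "b = (g + min 1 (2 * s)) / 2"
  have b: "g < b" "b < 1" "b < 2 * s" "0 < b" using g by (auto simp: b_def min_def)
  have u: "continuous_on UNIV u" "\<And>x. 0 < u x"
    using sol by (auto simp: viscosity_solution_def viscosity_subsolution_def viscosity_supersolution_def
        intro: semicontinuous_imp_continuous_on)
  obtain \<rho> \<sigma> where \<rho>: "0 < \<rho>" "\<rho> < 1" "0 < \<sigma>" "(2 + \<rho>) powr b + \<rho> powr b \<le> 2 - \<sigma>"
    by (rule strict_concavity_constants[OF b(4,2)])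
  define d where "d = u x1 - u y1"
  have d: "0 < d" using \<open>\<not> u x1 \<le> u y1\<close> by (simp add: d_def)
  \<comment> \<open>At \<open>(x1, y1)\<close> the power term uses at most half of \<open>d\<close>;
    the other half is left for the penalty. The summand 1 makes the denominator positive.\<close>
  define L where "L = d / (2 * (1 + norm (x1 - y1) powr b))"
  have den: "0 < 1 + norm (x1 - y1) powr b" by (simp add: add_pos_nonneg)
  have L: "0 < L" using d den by (simp add: L_def)
  have Ld: "L * norm (x1 - y1) powr b \<le> d / 2"
    using d den by (simp add: L_def field_simps)
  define K where "K = (1 + 2 * C) powr (1 / (b - g))"
  have K: "1 \<le> K" unfolding K_def using C b by (intro ge_one_powr_ge_zero) auto
  \<comment> \<open>Since \<open>1 + K * R \<le> 2 * K * R\<close>, the distance bound at the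
    maximum takes the form \<open>B * R powr g\<close>.\<close>
  define B where "B = C * (2 * K) powr g / L"
  have B: "0 < B" using C K L by (simp add: B_def)
  define \<kappa> where "\<kappa> = \<sigma> * (1 + \<rho>) powr (- (real CARD('n) + 2 * s)) * measure lborel (ball (0::real^'n) 1) * \<rho> ^ CARD('n)"
  have \<kappa>: "0 < \<kappa>" using \<rho> by (simp add: \<kappa>_def content_ball_pos)
  define E where "E = cutoff_mass TYPE('n) s b"
  \<comment> \<open>This equals \<open>g - 2 * s - g * ((b - 2 * s) / b)\<close>, the power of
    \<open>R\<close> left after inserting the distance bound; it is negative because
    \<open>g < b\<close>.\<close>
  define e where "e = 2 * s * (g / b - 1)"
  have e: "e < 0" using s g b by (simp add: e_def mult_pos_neg)
  have key: "L * \<kappa> * B powr ((b - 2 * s) / b) \<le> 2 * E * R powr e"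
    if R: "1 \<le> R" and small: "R powr (g - 2) * (norm x1)\<^sup>2 < d / 2" for R
  proof -
    have "penalty g b R x1 < d / 2"
      using penalty_le[of b R g x1] small b R by simp
    then have pos: "0 < u x1 - u y1 - L * norm (x1 - y1) powr b - penalty g b R x1"
      using Ld by (simp add: d_def)
    obtain x0 y0 where max: "\<And>x y. u x - u y - L * norm (x - y) powr b - penalty g b R x
       \<le> u x0 - u y0 - L * norm (x0 - y0) powr b - penalty g b R x0"
      and less: "u y0 < u x0"
      and dist: "norm (x0 - y0) powr b \<le> C * (1 + K * R) powr g / L"
      unfolding K_def
      using doubling_max_exists[OF g(1) b(1) less_imp_le[OF g(2)] R C L u growth pos] by blast
    let ?M = "\<lambda>z::real^'n. 2 * R powr g * cutoff b (norm z / R)"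
    have R0: "0 < R" using R by simp
    have int: "integrable lborel (\<lambda>z. ?M z / norm z powr (real CARD('n) + 2 * s))"
      using integrable_mult_right[OF integrable_cutoff[OF s b(3) R0, where 'n = 'n], of "2 * R powr g"]
      by simp
    have "L * \<kappa> * norm (x0 - y0) powr (b - 2 * s)
        \<le> (\<integral>z. ?M z / norm z powr (real CARD('n) + 2 * s) \<partial>lborel)"
      unfolding \<kappa>_def
      using b \<rho>
      by (intro doubling_estimate[OF c s p sol, where P = "penalty g b R"] L int less max
          continuous_on_penalty C2_on_penalty second_diff_penalty_le R0) auto
    also have "\<dots> = 2 * R powr g * (\<integral>(z::real^'n). cutoff b (norm z / R) / norm z powr (real CARD('n) + 2 * s) \<partial>lborel)"
      by (subst integral_mult_right_zero[symmetric]) (simp only: times_divide_eq_right)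
    also have "\<dots> = 2 * E * (R powr g * R powr (- 2 * s))"
      unfolding integral_cutoff[OF s b(3) R0] E_def by simp
    finally have upper: "L * \<kappa> * norm (x0 - y0) powr (b - 2 * s) \<le> 2 * E * (R powr g * R powr (- 2 * s))" .
    have a: "0 < norm (x0 - y0)" using less by auto
    have "1 * 1 \<le> K * R" using K R by (intro mult_mono) auto
    then have "(1 + K * R) powr g \<le> (2 * K * R) powr g"
      using g by (intro powr_mono2) auto
    also have "\<dots> = (2 * K) powr g * R powr g" using K R by (simp add: powr_mult)
    finally have "C * (1 + K * R) powr g / L \<le> B * R powr g"
      using C L by (simp add: B_def field_simps)
    with dist have "norm (x0 - y0) powr b \<le> B * R powr g" by linarith
    \<comment> \<open>The exponent \<open>(b - 2 * s) / b\<close> is negative, so the upper bound on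
      the distance becomes a lower bound.\<close>
    then have "(B * R powr g) powr ((b - 2 * s) / b) \<le> (norm (x0 - y0) powr b) powr ((b - 2 * s) / b)"
      using a b by (intro powr_mono2') (auto simp: field_simps)
    also have "\<dots> = norm (x0 - y0) powr (b - 2 * s)" using b by (simp add: powr_powr)
    finally have "L * \<kappa> * (B * R powr g) powr ((b - 2 * s) / b) \<le> 2 * E * (R powr g * R powr (- 2 * s))"
      using upper mult_left_mono[of _ _ "L * \<kappa>"] L \<kappa> by (smt (verit) mult_nonneg_nonneg)
    then have "L * \<kappa> * B powr ((b - 2 * s) / b) * R powr (g * ((b - 2 * s) / b))
        \<le> 2 * E * (R powr g * R powr (- 2 * s))"
      using B R by (simp add: powr_mult powr_powr mult.assoc)
    then have "L * \<kappa> * B powr ((b - 2 * s) / b)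
        \<le> 2 * E * (R powr g * R powr (- 2 * s)) / R powr (g * ((b - 2 * s) / b))"
      using R0 by (simp add: le_divide_eq)
    also have "R powr g * R powr (- 2 * s) / R powr (g * ((b - 2 * s) / b)) = R powr e"
    proof -
      have "g + - 2 * s - g * ((b - 2 * s) / b) = e"
        using b by (simp add: e_def field_simps)
      then show ?thesis by (simp only: powr_add[symmetric] powr_diff[symmetric])
    qed
    then have "2 * E * (R powr g * R powr (- 2 * s)) / R powr (g * ((b - 2 * s) / b)) = 2 * E * R powr e"
      by (simp only: times_divide_eq_right[symmetric])
    finally show ?thesis .
  qed
  have "((\<lambda>R. R powr (g - 2) * (norm x1)\<^sup>2) \<longlongrightarrow> 0 * (norm x1)\<^sup>2) at_top"
    using g by (intro tendsto_mult tendsto_const tendsto_neg_powr filterlim_ident) auto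
  then have "\<forall>\<^sub>F R in at_top. R powr (g - 2) * (norm x1)\<^sup>2 < d / 2"
    using d by (intro order_tendstoD) auto
  then have ev: "\<forall>\<^sub>F R in at_top. L * \<kappa> * B powr ((b - 2 * s) / b) \<le> 2 * E * R powr e"
    using eventually_ge_at_top[of 1] by eventually_elim (rule key)
  have "((\<lambda>R. 2 * E * R powr e) \<longlongrightarrow> 2 * E * 0) at_top"
    using e by (intro tendsto_mult tendsto_const tendsto_neg_powr filterlim_ident) auto
  from tendsto_lowerbound[OF this ev] have "L * \<kappa> * B powr ((b - 2 * s) / b) \<le> 0" by simp
  moreover have "0 < L * \<kappa> * B powr ((b - 2 * s) / b)" using L \<kappa> B by simp
  ultimately show False by simp
qed

text \<open>The constant serves as its own test function; its fractional Laplacian is 0, below the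
  positive number \<open>k powr (- p)\<close>.\<close>

lemma const_not_viscosity_supersolution:
  fixes k :: real
  assumes s: "0 < s" "s < 1"
  shows "\<not> viscosity_supersolution c s p (\<lambda>x::real^'n. k)"
proof
  assume super: "viscosity_supersolution c s p (\<lambda>x::real^'n. k)"
  then have L1: "in_L1_weight s (\<lambda>x::real^'n. k)" and k: "0 < k"
    by (auto simp: viscosity_supersolution_def)
  have glue: "glue 0 1 (\<lambda>x. k) (\<lambda>x::real^'n. k) = (\<lambda>x. k)" by (simp add: glue_def fun_eq_iff)
  have "k powr (- p) \<le> frac_laplacian c s (glue 0 1 (\<lambda>x. k) (\<lambda>x::real^'n. k)) 0"
    using super C2_on_const[of "ball 0 1" k] L1 glue
    unfolding viscosity_supersolution_def by (metis order_refl zero_less_one)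
  also have "\<dots> = 0"
    unfolding frac_laplacian_glue[OF s L1 zero_less_one continuous_on_const C2_on_const]
    by (simp add: glue second_diff_def)
  finally show False using k by simp
qed

theorem corollary1p7:
  fixes c s p \<gamma> :: real
  assumes "0 < c" and "0 < s" and "s < 1" and "0 < p"
    and "(2 * s \<le> 1 \<and> \<gamma> < 2 * s) \<or>
         (2 * s > 1 \<and> (\<gamma> < 1 \<or> 2 * s > \<gamma> * (1 + (p + 1) * (2 * s / (2 * s - 1)))))"
  shows "\<not> (\<exists>u :: real ^ 'n \<Rightarrow> real. viscosity_solution c s p u \<and>
            (\<exists>C. \<forall>x. \<bar>u x\<bar> \<le> C * (1 + norm x) powr \<gamma>))"
proof
  assume "\<exists>u :: real ^ 'n \<Rightarrow> real. viscosity_solution c s p u \<and>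
            (\<exists>C. \<forall>x. \<bar>u x\<bar> \<le> C * (1 + norm x) powr \<gamma>)"
  then obtain u :: "real ^ 'n \<Rightarrow> real" and C where sol: "viscosity_solution c s p u"
    and growth: "\<And>x. \<bar>u x\<bar> \<le> C * (1 + norm x) powr \<gamma>" by blast
  have pos: "0 < u x" for x
    using sol by (auto simp: viscosity_solution_def viscosity_subsolution_def)
  \<comment> \<open>For \<open>\<gamma> \<ge> 1\<close> the right-hand side would be at least 2,
    because the bracket is, whereas \<open>2 * s < 2\<close>.\<close>
  have "\<gamma> < 1" if "2 * s > 1" "2 * s > \<gamma> * (1 + (p + 1) * (2 * s / (2 * s - 1)))"
  proof (rule ccontr)
    assume "\<not> \<gamma> < 1"
    have "1 < 2 * s / (2 * s - 1)" using that(1) by (simp add: less_divide_eq)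
    then have "1 * 1 \<le> (p + 1) * (2 * s / (2 * s - 1))"
      using assms by (intro mult_mono) auto
    then have "1 * 2 \<le> \<gamma> * (1 + (p + 1) * (2 * s / (2 * s - 1)))"
      using \<open>\<not> \<gamma> < 1\<close> by (intro mult_mono) auto
    then show False using that(2) assms(3) by linarith
  qed
  then have \<gamma>: "\<gamma> < 1" "\<gamma> < 2 * s" using assms(5) by auto
  \<comment> \<open>A midpoint, with \<open>max \<gamma> 0\<close> because \<open>\<gamma>\<close>
    may be nonpositive while the doubling argument takes a positive exponent.\<close>
  define g where "g = (max \<gamma> 0 + min 1 (2 * s)) / 2"
  have g: "\<gamma> \<le> g" "0 < g" "g < 1" "g < 2 * s"
    using \<gamma> assms(2) by (auto simp: g_def max_def min_def)
  have C: "0 < C" using growth[of 0] pos[of 0] by simp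
  have "u x \<le> C * (1 + norm x) powr g" for x
  proof -
    have "u x \<le> C * (1 + norm x) powr \<gamma>" using growth[of x] by simp
    also have "\<dots> \<le> C * (1 + norm x) powr g"
      using C g by (intro mult_left_mono powr_mono) auto
    finally show ?thesis .
  qed
  then have "u x \<le> u y" for x y
    by (rule viscosity_solution_growth_imp_le[OF assms(1-4) sol g(2-4) C])
  then have "u = (\<lambda>x. u 0)" by (auto intro!: ext order_antisym)
  then show False
    using sol const_not_viscosity_supersolution[OF assms(2,3), of c p "u 0"]
    unfolding viscosity_solution_def by metis
qed

end
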